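(* Let $\pi_{L,N}$ be the canonical stationary measures with weights $w_L$ satisfying the standing assumptions in the context, and suppose $\gamma>\kappa+2>1$. Consider the thermodynamic limit $L,N=N_L\to\infty$ with $N/L\to\rho$, where $\rho>\rho_c$. Then, under $\pi_{L,N}$, $$\frac1L\max_{x\in\Lambda}\eta_x\overset{d}{\longrightarrow}\rho-\rho_c ,$$ and, equivalently, for a size-biased configuration $\tilde\eta$ under $\pi_{L,N}$, $$\tilde\eta_1/L\overset{d}{\longrightarrow}\begin{cases}0&\text{with probability }\rho_c/\rho,\\ \rho-\rho_c&\text{with probability }(\rho-\rho_c)/\rho .\end{cases}$$
   Context: Setting. For each $L$, $\Lambda=\Lambda_L$ is a finite index set with $|\Lambda|=L$, identified with $\{1,\dots,L\}$; configurations are $\eta=(\eta_x)_{x\in\Lambda}\in\mathbb{N}_0^\Lambda$, and $E_{L,N}=\{\eta\in\mathbb{N}_0^\Lambda:\sum_{x\in\Lambda}\eta_x=N\}$. The canonical measure on $E_{L,N}$ is $$\pi_{L,N}[\eta]=\frac{1}{Z_{L,N}}\prod_{x\in\Lambda}w_L(\eta_x),\qquad Z_{L,N}=\sum_{\eta\in E_{L,N}}\prod_{x\in\Lambda}w_L(\eta_x).$$ Standing assumptions on the weights. The $w_L$ are strictly positive and of the form $$w_L(n)=w(n)+\frac{\theta}{L^\gamma}(n+1)^\kappa\big(1+\delta_L(n)\big),\qquad n\in\mathbb{N}_0,$$ with constants $\theta>0$, $\gamma>0$, $\kappa>-1$, where $L\sup_{n\le N}|\delta_L(n)|\to0$ in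 the thermodynamic limit. The bulk weights $w:\mathbb{N}_0\to[0,\infty)$ satisfy: there is $\bar\phi\in(1,\infty]$ such that $z(\phi):=\sum_{n\ge0}w(n)\phi^n<\infty$ (for $\phi\ge 0$) if and only if $\phi\in[0,\bar\phi)$; $\sum_{n\ge0}w(n)=1$; and $\rho_c:=\sum_{n\ge0}n\,w(n)<\infty$. Put $R(\phi):=\frac{1}{z(\phi)}\sum_{n\ge0}n\,w(n)\phi^n$; it is continuous and increasing with $R(0)=0$, $R(1)=\rho_c$, and for every $\rho\ge0$ there is $\phi\in[0,\bar\phi)$ with $R(\phi)=\rho$. Size-biased configuration. Given $\eta\in E_{L,N}$ distributed according to $\pi_{L,N}$, define a random permutation $\sigma:\Lambda\to\Lambda$ recursively: $\sigma(1)=x$ with probability $\eta_x/N$ for $x\in\Lambda$, and $$\sigma(k+1)=x\ \text{ with probability }\ \frac{\eta_x}{N-(\eta_{\sigma(1)}+\dots+\eta_{\sigma(k)})},\qquad x\in\Lambda\setminus\{\sigma(1),\dots,\sigma(k)\}$$ (once all remaining sites are empty, the remaining order is arbitrary). The size-biased configuration is $\tilde\eta=(\tilde\eta_k)_{k=1}^L$ with $\tilde\eta_k=\eta_{\sigma(k)}$. *)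

theory Defs
  imports "HOL-Probability.Probability"
begin

type_synonym config = "nat \<Rightarrow> nat"

abbreviation sites :: "nat \<Rightarrow> nat set" where
  "sites L \<equiv> {1..L}"

definition configs :: "nat \<Rightarrow> nat \<Rightarrow> config set" where
  "configs L N = {\<eta> \<in> sites L \<rightarrow>\<^sub>E UNIV. (\<Sum>x\<in>sites L. \<eta> x) = N}"

definition partition_fun :: "(nat \<Rightarrow> real) \<Rightarrow> nat \<Rightarrow> nat \<Rightarrow> real" where
  "partition_fun W L N = (\<Sum>\<eta>\<in>configs L N. \<Prod>x\<in>sites L. W (\<eta> x))"

text \<open>The argument of \<open>embed_pmf\<close> is a probability mass function whenever \<open>W\<close> is positive
  and \<open>L > 0\<close>; see \<open>pmf_canonical\<close> below.\<close>

definition canonical :: "(nat \<Rightarrow> real) \<Rightarrow> nat \<Rightarrow> nat \<Rightarrow> config pmf" where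
  "canonical W L N = embed_pmf (\<lambda>\<eta>.
     if \<eta> \<in> configs L N then (\<Prod>x\<in>sites L. W (\<eta> x)) / partition_fun W L N else 0)"

definition bulk_z :: "(nat \<Rightarrow> real) \<Rightarrow> real \<Rightarrow> real" where
  "bulk_z w \<phi> = (\<Sum>n. w n * \<phi> ^ n)"

definition bulk_density :: "(nat \<Rightarrow> real) \<Rightarrow> real \<Rightarrow> real" where
  "bulk_density w \<phi> = (\<Sum>n. real n * w n * \<phi> ^ n) / bulk_z w \<phi>"

definition critical_density :: "(nat \<Rightarrow> real) \<Rightarrow> real" where
  "critical_density w = (\<Sum>n. real n * w n)"

text \<open>\<open>next_site tie L N \<eta> k \<sigma>\<close> is the law of \<open>\<sigma>(k+1)\<close> given \<open>\<eta>\<close> and \<open>\<sigma>(1), \<dots>, \<sigma>(k)\<close>.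
  The kernel \<open>tie\<close> is the arbitrary (possibly random) rule that is used once all
  remaining sites are empty; the only requirement on it is \<open>valid_tie\<close>.\<close>

definition next_site ::
  "(config \<Rightarrow> nat \<Rightarrow> (nat \<Rightarrow> nat) \<Rightarrow> nat pmf) \<Rightarrow> nat \<Rightarrow> nat \<Rightarrow> config \<Rightarrow> nat \<Rightarrow> (nat \<Rightarrow> nat) \<Rightarrow> nat pmf" where
  "next_site tie L N \<eta> k \<sigma> =
     (if (\<Sum>j\<in>{1..k}. \<eta> (\<sigma> j)) < N
      then embed_pmf (\<lambda>x. if x \<in> sites L - \<sigma> ` {1..k}
                          then real (\<eta> x) / (real N - (\<Sum>j\<in>{1..k}. real (\<eta> (\<sigma> j)))) else 0)
      else tie \<eta> k \<sigma>)"

definition valid_tie :: "nat \<Rightarrow> (config \<Rightarrow> nat \<Rightarrow> (nat \<Rightarrow> nat) \<Rightarrow> nat pmf) \<Rightarrow> bool" where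
  "valid_tie L tie \<longleftrightarrow> (\<forall>\<eta> k \<sigma>. k < L \<longrightarrow> set_pmf (tie \<eta> k \<sigma>) \<subseteq> sites L - \<sigma> ` {1..k})"

text \<open>Law of \<open>(\<sigma>(1), \<dots>, \<sigma>(k))\<close> given \<open>\<eta>\<close>, as a function that is \<open>undefined\<close> off \<open>{1..k}\<close>.\<close>

primrec size_biased_order ::
  "(config \<Rightarrow> nat \<Rightarrow> (nat \<Rightarrow> nat) \<Rightarrow> nat pmf) \<Rightarrow> nat \<Rightarrow> nat \<Rightarrow> config \<Rightarrow> nat \<Rightarrow> (nat \<Rightarrow> nat) pmf" where
  "size_biased_order tie L N \<eta> 0 = return_pmf (\<lambda>_. undefined)"
| "size_biased_order tie L N \<eta> (Suc k) =
     bind_pmf (size_biased_order tie L N \<eta> k) (\<lambda>\<sigma>.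
       map_pmf (\<lambda>x. \<sigma>(Suc k := x)) (next_site tie L N \<eta> k \<sigma>))"

definition size_biased ::
  "(config \<Rightarrow> nat \<Rightarrow> (nat \<Rightarrow> nat) \<Rightarrow> nat pmf) \<Rightarrow> (nat \<Rightarrow> real) \<Rightarrow> nat \<Rightarrow> nat \<Rightarrow> config pmf" where
  "size_biased tie W L N =
     bind_pmf (canonical W L N) (\<lambda>\<eta>.
       map_pmf (\<lambda>\<sigma>. \<lambda>k\<in>{1..L}. \<eta> (\<sigma> k)) (size_biased_order tie L N \<eta> L))"


lemma finite_configs: "finite (configs L N)"
proof (rule finite_subset)
  show "configs L N \<subseteq> sites L \<rightarrow>\<^sub>E {..N}"
  proof
    fix \<eta> assume "\<eta> \<in> configs L N"
    then have e: "\<eta> \<in> sites L \<rightarrow>\<^sub>E UNIV" and s: "(\<Sum>x\<in>sites L. \<eta> x) = N"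
      by (auto simp: configs_def)
    have "\<eta> x \<le> N" if "x \<in> sites L" for x
      using member_le_sum[of x "sites L" \<eta>] that s by simp
    then show "\<eta> \<in> sites L \<rightarrow>\<^sub>E {..N}"
      using e by (auto simp: PiE_iff)
  qed
  show "finite (sites L \<rightarrow>\<^sub>E {..N})"
    by (intro finite_PiE) auto
qed

lemma configs_nonempty:
  assumes "L > 0" shows "configs L N \<noteq> {}"
proof -
  have "(\<Sum>x\<in>sites L. (\<lambda>x\<in>sites L. if x = 1 then N else 0) x) = (\<Sum>x\<in>sites L. if x = 1 then N else 0)"
    by (intro sum.cong) auto
  also have "\<dots> = N"
    using assms by (subst sum.delta) auto
  finally have "(\<lambda>x\<in>sites L. if x = 1 then N else 0) \<in> configs L N"
    unfolding configs_def by (auto simp del: restrict_apply)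
  then show ?thesis by blast
qed

lemma pmf_embed_finite:
  fixes f :: "'a \<Rightarrow> real"
  assumes "finite A" "\<And>x. x \<in> A \<Longrightarrow> f x \<ge> 0" "(\<Sum>x\<in>A. f x) = 1"
  shows "pmf (embed_pmf (\<lambda>x. if x \<in> A then f x else 0)) y = (if y \<in> A then f y else 0)"
proof (rule pmf_embed_pmf)
  show "(if x \<in> A then f x else 0) \<ge> 0" for x
    using assms by auto
  have "(\<integral>\<^sup>+x. ennreal (if x \<in> A then f x else 0) \<partial>count_space UNIV) = (\<Sum>x\<in>A. ennreal (f x))"
    using assms(1) by (subst nn_integral_count_space'[of A]) (auto intro!: sum.cong)
  also have "\<dots> = ennreal (\<Sum>x\<in>A. f x)"
    using assms by (intro sum_ennreal) auto
  finally show "(\<integral>\<^sup>+x. ennreal (if x \<in> A then f x else 0) \<partial>count_space UNIV) = 1"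
    using assms(3) by simp
qed

lemma pmf_canonical:
  assumes "L > 0" "\<And>n. W n > 0"
  shows "pmf (canonical W L N) \<eta> =
    (if \<eta> \<in> configs L N then (\<Prod>x\<in>sites L. W (\<eta> x)) / partition_fun W L N else 0)"
proof -
  have pos: "partition_fun W L N > 0"
    unfolding partition_fun_def
    using assms finite_configs configs_nonempty by (intro sum_pos) (auto intro!: prod_pos)
  have "(\<Sum>\<eta>\<in>configs L N. (\<Prod>x\<in>sites L. W (\<eta> x)) / partition_fun W L N) = 1"
  proof -
    have "(\<Sum>\<eta>\<in>configs L N. (\<Prod>x\<in>sites L. W (\<eta> x)) / partition_fun W L N)
        = (\<Sum>\<eta>\<in>configs L N. \<Prod>x\<in>sites L. W (\<eta> x)) / partition_fun W L N"
      by (rule sum_divide_distrib[symmetric])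
    also have "\<dots> = partition_fun W L N / partition_fun W L N"
      unfolding partition_fun_def by (rule refl)
    finally show ?thesis using pos by simp
  qed
  moreover have "(\<Prod>x\<in>sites L. W (\<eta> x)) / partition_fun W L N \<ge> 0" for \<eta>
    using pos assms(2) by (intro divide_nonneg_pos prod_nonneg) (auto intro: less_imp_le)
  ultimately show ?thesis
    unfolding canonical_def by (intro pmf_embed_finite finite_configs) auto
qed

lemma pmf_next_site:
  assumes "\<eta> \<in> configs L N" "inj_on \<sigma> {1..k}" "\<sigma> ` {1..k} \<subseteq> sites L"
    and "(\<Sum>j\<in>{1..k}. \<eta> (\<sigma> j)) < N"
  shows "pmf (next_site tie L N \<eta> k \<sigma>) x =
    (if x \<in> sites L - \<sigma> ` {1..k}
     then real (\<eta> x) / (real N - (\<Sum>j\<in>{1..k}. real (\<eta> (\<sigma> j)))) else 0)"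
proof -
  let ?A = "sites L - \<sigma> ` {1..k}"
  let ?D = "real N - (\<Sum>j\<in>{1..k}. real (\<eta> (\<sigma> j)))"
  have "(\<Sum>j\<in>{1..k}. real (\<eta> (\<sigma> j))) < real N"
    using assms(4) by (metis of_nat_less_iff of_nat_sum)
  then have pos: "?D > 0" by simp
  have "(\<Sum>x\<in>?A. real (\<eta> x)) = (\<Sum>x\<in>sites L. real (\<eta> x)) - (\<Sum>x\<in>\<sigma> ` {1..k}. real (\<eta> x))"
    using assms(3) by (intro sum_diff) auto
  also have "(\<Sum>x\<in>sites L. real (\<eta> x)) = real N"
    using assms(1) by (auto simp: configs_def simp flip: of_nat_sum)
  also have "(\<Sum>x\<in>\<sigma> ` {1..k}. real (\<eta> x)) = (\<Sum>j\<in>{1..k}. real (\<eta> (\<sigma> j)))"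
    using assms(2) by (simp add: sum.reindex)
  finally have "(\<Sum>x\<in>?A. real (\<eta> x) / ?D) = 1"
    using pos by (simp add: sum_divide_distrib[symmetric])
  moreover have "real (\<eta> x) / ?D \<ge> 0" for x
    using pos by simp
  ultimately have "pmf (embed_pmf (\<lambda>x. if x \<in> ?A then real (\<eta> x) / ?D else 0)) x =
      (if x \<in> ?A then real (\<eta> x) / ?D else 0)"
    by (intro pmf_embed_finite) auto
  then show ?thesis
    using assms(4) by (simp add: next_site_def)
qed

lemma size_biased_order_inj:
  assumes "\<eta> \<in> configs L N" "valid_tie L tie" "k \<le> L" "\<sigma> \<in> set_pmf (size_biased_order tie L N \<eta> k)"
  shows "inj_on \<sigma> {1..k} \<and> \<sigma> ` {1..k} \<subseteq> sites L"
  using assms(3,4)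
proof (induction k arbitrary: \<sigma>)
  case 0
  then show ?case by simp
next
  case (Suc k)
  from Suc.prems obtain \<tau> x where \<tau>: "\<tau> \<in> set_pmf (size_biased_order tie L N \<eta> k)"
    and x: "x \<in> set_pmf (next_site tie L N \<eta> k \<tau>)" and \<sigma>: "\<sigma> = \<tau>(Suc k := x)"
    by auto
  have IH: "inj_on \<tau> {1..k}" "\<tau> ` {1..k} \<subseteq> sites L"
    using Suc.IH[OF _ \<tau>] Suc.prems by auto
  have xA: "x \<in> sites L - \<tau> ` {1..k}"
  proof (cases "(\<Sum>j\<in>{1..k}. \<eta> (\<tau> j)) < N")
    case True
    show ?thesis
    proof (rule ccontr)
      assume "x \<notin> sites L - \<tau> ` {1..k}"
      then have "pmf (next_site tie L N \<eta> k \<tau>) x = 0"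
        by (subst pmf_next_site[OF assms(1) IH True]) (rule if_not_P)
      with x show False by (simp only: set_pmf_iff)
    qed
  next
    case False
    then have "x \<in> set_pmf (tie \<eta> k \<tau>)"
      using x by (simp add: next_site_def)
    moreover have "set_pmf (tie \<eta> k \<tau>) \<subseteq> sites L - \<tau> ` {1..k}"
      using assms(2) Suc.prems(1) unfolding valid_tie_def by (meson Suc_le_lessD)
    ultimately show ?thesis by (rule subsetD[rotated])
  qed
  have eq: "\<sigma> ` {1..k} = \<tau> ` {1..k}"
    using \<sigma> by (intro image_cong) auto
  have "inj_on \<sigma> {1..k}"
    using IH(1) \<sigma> by (subst inj_on_cong[of _ _ \<tau>]) auto
  moreover have "{1..Suc k} = insert (Suc k) {1..k}" and "\<sigma> (Suc k) = x"
    using \<sigma> by auto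
  moreover have "\<sigma> ` ({1..k} - {Suc k}) = \<tau> ` {1..k}"
    using eq by simp
  ultimately show ?case
    using xA IH(2) eq by (metis DiffD1 DiffD2 image_insert inj_on_insert insert_subset)
qed

lemma size_biased_order_permutation:
  assumes "\<eta> \<in> configs L N" "valid_tie L tie" "\<sigma> \<in> set_pmf (size_biased_order tie L N \<eta> L)"
  shows "bij_betw \<sigma> (sites L) (sites L)"
proof -
  have "inj_on \<sigma> (sites L)" "\<sigma> ` sites L \<subseteq> sites L"
    using size_biased_order_inj[OF assms(1,2) order_refl assms(3)] by blast+
  then show ?thesis
    unfolding bij_betw_def using endo_inj_surj[of "sites L" \<sigma>] by (intro conjI) simp_all
qed

lemma valid_tie_exists: "\<exists>tie. valid_tie L tie"
proof -
  have ne: "sites L - \<sigma> ` {1..k} \<noteq> {}" if "k < L" for k and \<sigma> :: "nat \<Rightarrow> nat"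
  proof
    assume "sites L - \<sigma> ` {1..k} = {}"
    then have "card (sites L) \<le> card (\<sigma> ` {1..k})"
      by (intro card_mono) auto
    also have "\<dots> \<le> k"
      using card_image_le[of "{1..k}" \<sigma>] by simp
    finally show False using that by simp
  qed
  have "valid_tie L (\<lambda>\<eta> k \<sigma>. pmf_of_set (sites L - \<sigma> ` {1..k}))"
    using ne by (simp add: valid_tie_def)
  then show ?thesis by blast
qed

end

(* Call a site large if it carries more than aL particles, for a small a > 0. Under the product of
   the weights wL, the configurations without a large site have total mass at most L^(-p) on a density
   above rhoc: this is a Chernoff bound with a tilt of order ln L / L, which keeps the perturbation
   term summable because gamma > kappa + 2. The same bound, used with both signs of the tilt, shows
   that the sites other than a single large one carry about rhoc L particles. Two large sites cost
   an additional factor L^(kappa + 2 - gamma) compared with one. One large site on top of a typical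
   bulk gives a lower bound of order L^(1 + kappa - gamma) for the partition function, which
   dominates all of these. Hence with probability tending to 1 one site carries
   (rho - rhoc + o(1)) L particles and every other one o(L). A size-biased pick hits that site with
   probability close to (rho - rhoc) / rho. *)

theory Submission
  imports Defs "HOL-Real_Asymp.Real_Asymp"
begin

text \<open>Under the canonical measure the occupations are not independent, because their total is
  fixed. No local limit theorem is used to handle this. Instead the constraint determines the
  occupation of one distinguished site from all the others: a set of configurations injects into its
  restrictions off that site, and a restriction with few enough particles is completed in exactly
  one way. Every estimate thus becomes an unnormalised product mass over free sites times the weight
  at the distinguished site. A tilt \<open>s\<close> of order 1 is excluded, since the perturbation
  decays at most polynomially in \<open>L\<close> up to occupation \<open>a * L\<close>, where it
  would be multiplied by \<open>exp (s * a * L)\<close>. The logarithmic tilt yields only polynomial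
  decay, but the partition function is itself bounded below by a power of \<open>L\<close>, so a
  large enough exponent wins. The order of choice matters: the accuracy fixes the size of the tilt,
  and only then is \<open>a\<close> taken small against it.\<close>

section \<open>Elementary estimates for exponentials, powers and the bulk weights\<close>

text \<open>Taylor formula with Lagrange remainder. The factor \<open>exp \<bar>x\<bar>\<close> is
  kept because \<open>x = s * n\<close> will be unbounded in \<open>n\<close>; an exponential moment
  of \<open>w\<close> pays for it.\<close>

lemma exp_le_quadratic: "exp x \<le> 1 + x + x\<^sup>2 * exp \<bar>x\<bar>" for x :: real
proof -
  obtain t where t: "\<bar>t\<bar> \<le> \<bar>x\<bar>" "exp x = (\<Sum>m<2. x ^ m / fact m) + exp t / fact 2 * x\<^sup>2"
    using Maclaurin_exp_le[of x 2] by blast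
  have "exp t / 2 * x\<^sup>2 \<le> exp \<bar>x\<bar> * x\<^sup>2"
  proof (rule mult_right_mono)
    have "exp t \<le> exp \<bar>x\<bar>" using t(1) by simp
    then show "exp t / 2 \<le> exp \<bar>x\<bar>" using exp_gt_zero[of t] by linarith
  qed simp
  then show ?thesis
    using t(2) by (simp add: numeral_2_eq_2 mult.commute)
qed

text \<open>For \<kappa> \<ge> 0 the constant is 1, by monotonicity of
  \<open>x powr \<kappa>\<close>. For negative \<kappa> the mean value theorem gives \<kappa> + 1,
  the derivative being smallest at the right end; \<open>n = 0\<close> is set apart because the
  derivative blows up there.\<close>

lemma powr_add1_le_diff:
  fixes \<kappa> :: real
  assumes "\<kappa> > -1"
  shows "min 1 (\<kappa> + 1) * (real n + 1) powr \<kappa> \<le> (real n + 1) powr (\<kappa> + 1) - real n powr (\<kappa> + 1)"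
proof (cases "\<kappa> \<ge> 0")
  case True
  have "(real n + 1) powr (\<kappa> + 1) = (real n + 1) * (real n + 1) powr \<kappa>"
    by (simp add: powr_add)
  moreover have "real n powr (\<kappa> + 1) = real n * real n powr \<kappa>"
    by (cases "n = 0") (simp_all add: powr_add)
  moreover have "real n * real n powr \<kappa> \<le> real n * (real n + 1) powr \<kappa>"
    using True by (intro mult_left_mono powr_mono2) auto
  ultimately show ?thesis using True by (simp add: algebra_simps)
next
  case False
  show ?thesis
  proof (cases "n = 0")
    case True
    then show ?thesis by simp
  next
    case n: False
    have "\<exists>z. real n < z \<and> z < real n + 1 \<and>
        (real n + 1) powr (\<kappa> + 1) - real n powr (\<kappa> + 1) = (real n + 1 - real n) * ((\<kappa> + 1) * z powr \<kappa>)"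
    proof (rule MVT2)
      fix x assume "real n \<le> x"
      then have "x > 0" using n by linarith
      then show "((\<lambda>x. x powr (\<kappa> + 1)) has_real_derivative (\<kappa> + 1) * x powr \<kappa>) (at x)"
        by (auto intro!: derivative_eq_intros)
    qed simp
    then obtain z where z: "real n < z" "z < real n + 1"
      "(real n + 1) powr (\<kappa> + 1) - real n powr (\<kappa> + 1) = (\<kappa> + 1) * z powr \<kappa>"
      by auto
    have "(real n + 1) powr \<kappa> \<le> z powr \<kappa>"
      using z n False by (intro powr_mono2') auto
    then have "(\<kappa> + 1) * (real n + 1) powr \<kappa> \<le> (\<kappa> + 1) * z powr \<kappa>"
      using assms by (intro mult_left_mono) auto
    then show ?thesis using z(3) False by (simp add: min_def)
  qed
qed

text \<open>Telescoping. It gives the perturbation a total of order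
  \<open>L powr (\<kappa> + 1 - \<gamma>)\<close> over occupations of order \<open>L\<close>, which
  is o(1 / L) because \<gamma> > \<kappa> + 2.\<close>

lemma sum_powr_le:
  fixes \<kappa> :: real
  assumes "\<kappa> > -1"
  shows "(\<Sum>n\<le>M. (real n + 1) powr \<kappa>) \<le> (real M + 1) powr (\<kappa> + 1) / min 1 (\<kappa> + 1)"
proof -
  have "(\<Sum>n\<le>M. min 1 (\<kappa> + 1) * (real n + 1) powr \<kappa>)
      \<le> (\<Sum>n\<le>M. real (Suc n) powr (\<kappa> + 1) - real n powr (\<kappa> + 1))"
    using powr_add1_le_diff[OF assms] by (intro sum_mono) (simp add: add.commute)
  also have "\<dots> = real (Suc M) powr (\<kappa> + 1) - real 0 powr (\<kappa> + 1)"
    by (induction M) simp_all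
  finally have "min 1 (\<kappa> + 1) * (\<Sum>n\<le>M. (real n + 1) powr \<kappa>) \<le> (real M + 1) powr (\<kappa> + 1)"
    by (simp add: sum_distrib_left add.commute)
  moreover have "min 1 (\<kappa> + 1) > 0" using assms by simp
  ultimately show ?thesis by (simp only: pos_le_divide_eq mult.commute)
qed

text \<open>Everything the proof needs about \<open>w\<close> follows from one point of convergence
  beyond 1: a quadratic bound on the tilted total whose linear coefficient is the critical density,
  exponential decay, and a tail of order \<open>1 / b\<^sup>2\<close>, summable over
  \<open>L\<close> sites when \<open>b\<close> is of order \<open>L\<close>.\<close>

lemma exp_moment_bounds:
  fixes w :: "nat \<Rightarrow> real"
  assumes w: "\<And>n. w n \<ge> 0" "w sums 1" "summable (\<lambda>n. real n * w n)"
    and \<phi>: "\<phi> > 1" "summable (\<lambda>n. w n * \<phi> ^ n)"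
  obtains r K where "r > 0" "K > 0"
    "\<And>s b. \<bar>s\<bar> \<le> r \<Longrightarrow> (\<Sum>n\<le>b. w n * exp (s * real n)) \<le> 1 + s * (\<Sum>n. real n * w n) + K * s\<^sup>2"
    "\<And>n. w n \<le> K * exp (- r * real n)"
    "\<And>b. 1 - K / (real b + 1)\<^sup>2 \<le> (\<Sum>n\<le>b. w n)"
proof -
  \<comment> \<open>Half of \<open>ln \<phi>\<close>, so that \<open>\<phi> ^ n\<close> splits into
    two factors \<open>exp (r * n)\<close>: one absorbs \<open>n\<^sup>2\<close>, the other the
    remainder \<open>exp \<bar>s * n\<bar>\<close> for \<open>\<bar>s\<bar> \<le> r\<close>.\<close>
  define r where "r = ln \<phi> / 2"
  define S where "S = (\<Sum>n. w n * \<phi> ^ n)"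
  define K where "K = (4 / r\<^sup>2 + 1) * S"
  have r: "r > 0" using \<phi> by (simp add: r_def)
  have pow: "\<phi> ^ n = exp (r * real n) * exp (r * real n)" for n
  proof -
    have "exp (r * real n) * exp (r * real n) = exp (real n * ln \<phi>)"
      by (simp add: r_def flip: exp_add)
    then show ?thesis using \<phi>(1) by (simp add: exp_of_nat_mult)
  qed
  have w_sum: "summable w" "(\<Sum>n. w n) = 1" using w(2) by (auto simp: sums_iff)
  have S1: "1 \<le> S"
    unfolding S_def w_sum(2)[symmetric]
  proof (rule suminf_le)
    show "w n \<le> w n * \<phi> ^ n" for n
      using mult_left_mono[OF one_le_power[of \<phi> n] w(1)[of n]] \<phi>(1) by simp
  qed fact+
  have "0 < 4 / r\<^sup>2" using r by simp
  then have "S \<le> K" unfolding K_def using S1 by (simp add: mult_le_cancel_right1)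
  then have K: "K > 0" using S1 by linarith
  \<comment> \<open>This is \<open>x \<le> exp x\<close> at \<open>x = r * n / 2\<close>,
    squared.\<close>
  have sq: "(real n)\<^sup>2 * exp (r * real n) \<le> 4 / r\<^sup>2 * \<phi> ^ n" for n
  proof -
    have "r * real n / 2 \<le> exp (r * real n / 2)" using exp_ge_add_one_self[of "r * real n / 2"] by linarith
    then have "(r * real n / 2)\<^sup>2 \<le> (exp (r * real n / 2))\<^sup>2"
      using r by (intro power_mono) auto
    also have "\<dots> = exp (r * real n)" by (simp add: power2_eq_square flip: exp_add)
    finally have "(real n)\<^sup>2 \<le> 4 / r\<^sup>2 * exp (r * real n)"
      using r by (simp add: field_simps power2_eq_square)
    from mult_right_mono[OF this, of "exp (r * real n)"] show ?thesis
      by (simp only: pow mult.assoc exp_ge_zero simp_thms)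
  qed
  have bound2: "w n * ((real n)\<^sup>2 * exp (r * real n)) \<le> 4 / r\<^sup>2 * (w n * \<phi> ^ n)" for n
    using mult_left_mono[OF sq w(1), of n n] by (simp only: mult.left_commute)
  have summ2: "summable (\<lambda>n. w n * ((real n)\<^sup>2 * exp (r * real n)))"
  proof (rule summable_comparison_test'[where N = 0])
    show "summable (\<lambda>n. 4 / r\<^sup>2 * (w n * \<phi> ^ n))"
      using \<phi>(2) by (rule summable_mult)
    have "\<bar>w n * ((real n)\<^sup>2 * exp (r * real n))\<bar> = w n * ((real n)\<^sup>2 * exp (r * real n))" for n
      using w(1)[of n] by (intro abs_of_nonneg mult_nonneg_nonneg) simp_all
    then show "norm (w n * ((real n)\<^sup>2 * exp (r * real n))) \<le> 4 / r\<^sup>2 * (w n * \<phi> ^ n)" for n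
      using bound2[of n] by (simp only: real_norm_def)
  qed
  have suminf2: "(\<Sum>n. w n * ((real n)\<^sup>2 * exp (r * real n))) \<le> K"
  proof -
    have "(\<Sum>n. w n * ((real n)\<^sup>2 * exp (r * real n))) \<le> (\<Sum>n. 4 / r\<^sup>2 * (w n * \<phi> ^ n))"
      using bound2 summ2 summable_mult[OF \<phi>(2)] by (rule suminf_le)
    also have "\<dots> = 4 / r\<^sup>2 * S" unfolding S_def using \<phi>(2) by (rule suminf_mult)
    also have "\<dots> \<le> K" unfolding K_def using S1 by (simp add: distrib_right)
    finally show ?thesis .
  qed
  show ?thesis
  proof
    show "r > 0" "K > 0" by fact+
  next
    fix s :: real and b assume s: "\<bar>s\<bar> \<le> r"
    define q where "q n = w n + s * (real n * w n) + s\<^sup>2 * (w n * ((real n)\<^sup>2 * exp (r * real n)))" for n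
    have le: "w n * exp (s * real n) \<le> q n" for n
    proof -
      have "\<bar>s * real n\<bar> \<le> r * real n" using s by (simp add: abs_mult mult_right_mono)
      then have "(s * real n)\<^sup>2 * exp \<bar>s * real n\<bar> \<le> (s * real n)\<^sup>2 * exp (r * real n)"
        by (intro mult_left_mono) auto
      then have "exp (s * real n) \<le> 1 + s * real n + s\<^sup>2 * ((real n)\<^sup>2 * exp (r * real n))"
        using exp_le_quadratic[of "s * real n"] by (simp add: power_mult_distrib mult.assoc)
      from mult_left_mono[OF this w(1)[of n]] show ?thesis
        by (simp add: q_def algebra_simps)
    qed
    have q: "summable q" unfolding q_def
      using w_sum w(3) summ2 by (intro summable_add summable_mult)
    have "(\<Sum>n\<le>b. w n * exp (s * real n)) \<le> (\<Sum>n\<le>b. q n)" using le by (intro sum_mono)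
    also have "\<dots> \<le> suminf q"
      using q le w(1) by (intro sum_le_suminf) (auto intro: order_trans[OF _ le])
    also have "suminf q = 1 + s * (\<Sum>n. real n * w n) + s\<^sup>2 * (\<Sum>n. w n * ((real n)\<^sup>2 * exp (r * real n)))"
      unfolding q_def using w_sum w(3) summ2
      by (simp add: suminf_add[symmetric] summable_add summable_mult suminf_mult)
    also have "\<dots> \<le> 1 + s * (\<Sum>n. real n * w n) + K * s\<^sup>2"
      using mult_left_mono[OF suminf2, of "s\<^sup>2"] by (simp add: mult.commute)
    finally show "(\<Sum>n\<le>b. w n * exp (s * real n)) \<le> 1 + s * (\<Sum>n. real n * w n) + K * s\<^sup>2" .
  next
    fix n
    have "w n * exp (r * real n) \<le> w n * \<phi> ^ n"
      unfolding pow using w(1)[of n] r by (intro mult_left_mono) (auto simp: mult_le_cancel_left1)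
    also have "\<dots> \<le> S" unfolding S_def
      using sum_le_suminf[OF \<phi>(2), of "{n}"] w(1) \<phi>(1) by simp
    finally have "w n * exp (r * real n) \<le> K" using \<open>S \<le> K\<close> by linarith
    then show "w n \<le> K * exp (- r * real n)"
      by (simp add: exp_minus field_simps)
  next
    fix b
    have "(\<Sum>n. w n) = (\<Sum>n. w (n + Suc b)) + (\<Sum>n<Suc b. w n)"
      using w_sum(1) by (rule suminf_split_initial_segment)
    \<comment> \<open>Chebyshev with the second moment: beyond \<open>b\<close> the inserted ratio
      is at least 1.\<close>
    also have "(\<Sum>n. w (n + Suc b)) \<le> (\<Sum>n. w (n + Suc b) * ((real (n + Suc b))\<^sup>2 * exp (r * real (n + Suc b))) / (real b + 1)\<^sup>2)"
    proof (rule suminf_le)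
      fix n
      have "(real b + 1)\<^sup>2 * 1 \<le> (real (n + Suc b))\<^sup>2 * exp (r * real (n + Suc b))"
        using r by (intro mult_mono power_mono) auto
      then have "1 \<le> ((real (n + Suc b))\<^sup>2 * exp (r * real (n + Suc b))) / (real b + 1)\<^sup>2"
        by (simp add: field_simps)
      from mult_left_mono[OF this w(1)[of "n + Suc b"]]
      show "w (n + Suc b) \<le> w (n + Suc b) * ((real (n + Suc b))\<^sup>2 * exp (r * real (n + Suc b))) / (real b + 1)\<^sup>2"
        by simp
    next
      show "summable (\<lambda>n. w (n + Suc b))" using w_sum(1) by (rule summable_ignore_initial_segment)
      show "summable (\<lambda>n. w (n + Suc b) * ((real (n + Suc b))\<^sup>2 * exp (r * real (n + Suc b))) / (real b + 1)\<^sup>2)"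
        using summable_ignore_initial_segment[OF summ2, of "Suc b"] by (rule summable_divide)
    qed
    also have "\<dots> = (\<Sum>n. w (n + Suc b) * ((real (n + Suc b))\<^sup>2 * exp (r * real (n + Suc b)))) / (real b + 1)\<^sup>2"
      using summable_ignore_initial_segment[OF summ2, of "Suc b"] by (rule suminf_divide)
    also have "\<dots> \<le> K / (real b + 1)\<^sup>2"
    proof (rule divide_right_mono)
      show "(\<Sum>n. w (n + Suc b) * ((real (n + Suc b))\<^sup>2 * exp (r * real (n + Suc b)))) \<le> K"
        using suminf_split_initial_segment[OF summ2, of "Suc b"] suminf2 w(1)
          sum_nonneg[of "{..<Suc b}" "\<lambda>n. w n * ((real n)\<^sup>2 * exp (r * real n))"]
        by (simp del: sum.lessThan_Suc)
    qed simp
    finally show "1 - K / (real b + 1)\<^sup>2 \<le> (\<Sum>n\<le>b. w n)"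
      using w_sum(2) by (simp add: lessThan_Suc_atMost)
  qed
qed

subsection \<open>Masses under product weights\<close>

text \<open>The unnormalised product measure with one-site weights \<open>W\<close>. The weights
  \<open>wL\<close> need not sum to 1, and \<open>A\<close> is left free so that a site can be
  removed; \<open>partition_fun W L n\<close> is the mass of \<open>configs L n\<close> over
  \<open>sites L\<close>.\<close>

definition mass :: "(nat \<Rightarrow> real) \<Rightarrow> 'a set \<Rightarrow> ('a \<Rightarrow> nat) set \<Rightarrow> real" where
  "mass W A E = (\<Sum>\<zeta>\<in>E. \<Prod>x\<in>A. W (\<zeta> x))"

lemma mass_PiE:
  assumes "finite A" "\<And>x. x \<in> A \<Longrightarrow> finite (B x)"
  shows "mass W A (PiE A B) = (\<Prod>x\<in>A. \<Sum>n\<in>B x. W n)"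
  unfolding mass_def using assms by (rule prod_sum_PiE[symmetric])

lemma mass_mono:
  assumes "finite F" "E \<subseteq> F" "\<And>\<zeta> x. \<zeta> \<in> F \<Longrightarrow> x \<in> A \<Longrightarrow> W (\<zeta> x) \<ge> 0"
  shows "mass W A E \<le> mass W A F"
  unfolding mass_def using assms by (intro sum_mono2) (auto intro!: prod_nonneg)

lemma mass_nonneg:
  assumes "\<And>\<zeta> x. \<zeta> \<in> E \<Longrightarrow> x \<in> A \<Longrightarrow> W (\<zeta> x) \<ge> 0"
  shows "mass W A E \<ge> 0"
  unfolding mass_def using assms by (auto intro!: prod_nonneg sum_nonneg)

lemma mass_Un_le:
  assumes "finite E" "finite F" "\<And>\<zeta> x. \<zeta> \<in> E \<union> F \<Longrightarrow> x \<in> A \<Longrightarrow> W (\<zeta> x) \<ge> 0"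
  shows "mass W A (E \<union> F) \<le> mass W A E + mass W A F"
proof -
  have "mass W A (E \<inter> F) \<ge> 0"
    using assms(3) by (intro mass_nonneg) auto
  then show ?thesis
    using assms(1,2) by (simp add: mass_def sum_Un)
qed

lemma mass_UN_le:
  assumes "finite I" "\<And>i. i \<in> I \<Longrightarrow> finite (E i)"
    "\<And>i \<zeta> x. i \<in> I \<Longrightarrow> \<zeta> \<in> E i \<Longrightarrow> x \<in> A \<Longrightarrow> W (\<zeta> x) \<ge> 0"
  shows "mass W A (\<Union>i\<in>I. E i) \<le> (\<Sum>i\<in>I. mass W A (E i))"
  using assms
proof (induction I rule: finite_induct)
  case empty
  then show ?case by (simp add: mass_def)
next
  case (insert i I)
  have "mass W A (\<Union>j\<in>insert i I. E j) \<le> mass W A (E i) + mass W A (\<Union>j\<in>I. E j)"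
    using mass_Un_le[of "E i" "\<Union>j\<in>I. E j" A W] insert.hyps insert.prems by fastforce
  also have "mass W A (\<Union>j\<in>I. E j) \<le> (\<Sum>j\<in>I. mass W A (E j))"
    using insert.prems by (intro insert.IH) blast+
  finally show ?case using insert.hyps by simp
qed

text \<open>Exponential Markov inequality: the factor \<open>exp (s * sum - t)\<close> is at least 1
  on the set and factorises over the sites. The threshold is put on \<open>s * sum\<close>, so that
  a negative \<open>s\<close> gives the lower tail.\<close>

lemma mass_chernoff:
  assumes "finite A" "\<And>n. n \<le> b \<Longrightarrow> W n \<ge> 0"
  shows "mass W A {\<zeta> \<in> A \<rightarrow>\<^sub>E {..b}. t \<le> s * real (\<Sum>x\<in>A. \<zeta> x)}
    \<le> exp (- t) * (\<Sum>n\<le>b. W n * exp (s * real n)) ^ card A"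
proof -
  let ?X = "A \<rightarrow>\<^sub>E {..b}"
  have fin: "finite ?X" using assms(1) by (intro finite_PiE) auto
  have W: "0 \<le> (\<Prod>x\<in>A. W (\<zeta> x))" if "\<zeta> \<in> ?X" for \<zeta>
    using that assms(2) by (intro prod_nonneg) (auto simp: PiE_iff)
  have "mass W A {\<zeta> \<in> ?X. t \<le> s * real (\<Sum>x\<in>A. \<zeta> x)}
      \<le> (\<Sum>\<zeta>\<in>{\<zeta> \<in> ?X. t \<le> s * real (\<Sum>x\<in>A. \<zeta> x)}. (\<Prod>x\<in>A. W (\<zeta> x)) * exp (s * real (\<Sum>x\<in>A. \<zeta> x) - t))"
    unfolding mass_def
  proof (rule sum_mono)
    fix \<zeta> assume \<zeta>: "\<zeta> \<in> {\<zeta> \<in> ?X. t \<le> s * real (\<Sum>x\<in>A. \<zeta> x)}"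
    then have "1 \<le> exp (s * real (\<Sum>x\<in>A. \<zeta> x) - t)" by simp
    from mult_left_mono[OF this W] \<zeta>
    show "(\<Prod>x\<in>A. W (\<zeta> x)) \<le> (\<Prod>x\<in>A. W (\<zeta> x)) * exp (s * real (\<Sum>x\<in>A. \<zeta> x) - t)" by simp
  qed
  also have "\<dots> \<le> (\<Sum>\<zeta>\<in>?X. (\<Prod>x\<in>A. W (\<zeta> x)) * exp (s * real (\<Sum>x\<in>A. \<zeta> x) - t))"
    using W fin by (intro sum_mono2) auto
  also have "\<dots> = (\<Sum>\<zeta>\<in>?X. exp (- t) * (\<Prod>x\<in>A. W (\<zeta> x) * exp (s * real (\<zeta> x))))"
  proof (rule sum.cong[OF refl])
    fix \<zeta> :: "'a \<Rightarrow> nat"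
    have "exp (s * real (\<Sum>x\<in>A. \<zeta> x) - t) = exp (- t) * exp (\<Sum>x\<in>A. s * real (\<zeta> x))"
      by (simp add: sum_distrib_left flip: exp_add)
    then show "(\<Prod>x\<in>A. W (\<zeta> x)) * exp (s * real (\<Sum>x\<in>A. \<zeta> x) - t)
        = exp (- t) * (\<Prod>x\<in>A. W (\<zeta> x) * exp (s * real (\<zeta> x)))"
      using assms(1) by (simp add: prod.distrib exp_sum)
  qed
  also have "\<dots> = exp (- t) * (\<Prod>x\<in>A. \<Sum>n\<le>b. W n * exp (s * real n))"
    using assms(1) by (subst prod_sum_PiE) (auto simp: sum_distrib_left)
  finally show ?thesis by simp
qed

text \<open>The fixed total makes restriction off \<open>x\<close> injective, so site
  \<open>x\<close> contributes its largest weight only once, without a sum over its occupation.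
  Afterwards the constraint may be forgotten, which leaves a product mass.\<close>

lemma mass_slice_le:
  assumes E: "E \<subseteq> configs L N" and x: "x \<in> sites L" and M: "\<And>\<eta>. \<eta> \<in> E \<Longrightarrow> W (\<eta> x) \<le> M"
    and F: "finite F" "\<And>\<eta>. \<eta> \<in> E \<Longrightarrow> restrict \<eta> (sites L - {x}) \<in> F"
    and W: "\<And>\<zeta> y. \<zeta> \<in> F \<Longrightarrow> y \<in> sites L - {x} \<Longrightarrow> W (\<zeta> y) \<ge> 0" and "M \<ge> 0"
  shows "mass W (sites L) E \<le> M * mass W (sites L - {x}) F"
proof -
  let ?A = "sites L - {x}"
  let ?r = "\<lambda>\<eta>. restrict \<eta> ?A"
  have prod: "(\<Prod>y\<in>?A. W (?r \<eta> y)) = (\<Prod>y\<in>?A. W (\<eta> y))" for \<eta>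
    by (intro prod.cong) auto
  have inj: "inj_on ?r E"
  proof (rule inj_onI)
    fix \<eta> \<eta>' assume *: "\<eta> \<in> E" "\<eta>' \<in> E" "?r \<eta> = ?r \<eta>'"
    have eq: "\<eta> y = \<eta>' y" if "y \<in> ?A" for y using fun_cong[OF *(3), of y] that by simp
    have tot: "\<eta> x + (\<Sum>y\<in>?A. \<eta> y) = N" "\<eta>' x + (\<Sum>y\<in>?A. \<eta>' y) = N"
      using * E sum.remove[OF _ x, of \<eta>] sum.remove[OF _ x, of \<eta>'] by (auto simp: configs_def)
    have "(\<Sum>y\<in>?A. \<eta> y) = (\<Sum>y\<in>?A. \<eta>' y)" using eq by (intro sum.cong) auto
    then have "\<eta> x = \<eta>' x" using tot by linarith
    then have "\<eta> y = \<eta>' y" if "y \<in> sites L" for y using eq that by (cases "y = x") auto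
    moreover have "\<eta> \<in> sites L \<rightarrow>\<^sub>E UNIV" "\<eta>' \<in> sites L \<rightarrow>\<^sub>E UNIV"
      using * E by (auto simp: configs_def)
    ultimately show "\<eta> = \<eta>'" by (intro PiE_ext[where k = "sites L" and s = "\<lambda>_. UNIV"])
  qed
  have "mass W (sites L) E = (\<Sum>\<eta>\<in>E. W (\<eta> x) * (\<Prod>y\<in>?A. W (?r \<eta> y)))"
    unfolding mass_def prod using x by (simp add: prod.remove)
  also have "\<dots> \<le> (\<Sum>\<eta>\<in>E. M * (\<Prod>y\<in>?A. W (?r \<eta> y)))"
    using M F(2) W by (intro sum_mono mult_right_mono prod_nonneg) blast+
  also have "\<dots> = M * mass W ?A (?r ` E)"
    using inj by (simp add: mass_def sum.reindex sum_distrib_left)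
  also have "\<dots> \<le> M * mass W ?A F"
    using F W \<open>M \<ge> 0\<close> by (intro mult_left_mono mass_mono) auto
  finally show ?thesis .
qed

text \<open>Converse gluing: the missing particles are put on \<open>x\<close>. Since
  \<open>x\<close> then exceeds \<open>b\<close> and all other sites stay at or below
  \<open>b\<close>, the images for different \<open>x\<close> are disjoint, and the slices add up
  without overcounting.\<close>

lemma mass_slices_ge:
  assumes F: "\<And>x. x \<in> sites L \<Longrightarrow> F x \<subseteq> sites L - {x} \<rightarrow>\<^sub>E {..b}"
    and big: "\<And>x \<zeta>. x \<in> sites L \<Longrightarrow> \<zeta> \<in> F x \<Longrightarrow> b + (\<Sum>y\<in>sites L - {x}. \<zeta> y) < N"
    and m: "\<And>x \<zeta>. x \<in> sites L \<Longrightarrow> \<zeta> \<in> F x \<Longrightarrow> m \<le> W (N - (\<Sum>y\<in>sites L - {x}. \<zeta> y))"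
    and W: "\<And>n. n \<le> N \<Longrightarrow> W n \<ge> 0" and "b \<le> N"
  shows "(\<Sum>x\<in>sites L. m * mass W (sites L - {x}) (F x)) \<le> partition_fun W L N"
proof -
  let ?S = "\<lambda>x \<zeta>. \<Sum>y\<in>sites L - {x}. \<zeta> y"
  define h where "h = (\<lambda>(x, \<zeta>). \<zeta>(x := N - ?S x \<zeta>))"
  let ?D = "Sigma (sites L) F"
  have finF: "finite (F x)" if "x \<in> sites L" for x
    using F[OF that] by (rule finite_subset) (auto intro: finite_PiE)
  have h_sum: "(\<Sum>y\<in>sites L - {x}. h (x, \<zeta>) y) = ?S x \<zeta>" for x \<zeta>
    by (intro sum.cong) (auto simp: h_def)
  have img: "h ` ?D \<subseteq> configs L N"
  proof (intro image_subsetI)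
    fix p assume "p \<in> ?D"
    then obtain x \<zeta> where p: "p = (x, \<zeta>)" "x \<in> sites L" "\<zeta> \<in> F x" by auto
    have "h p \<in> sites L \<rightarrow>\<^sub>E UNIV"
      using F[OF p(2)] p by (auto simp: h_def PiE_iff extensional_def)
    moreover have "(\<Sum>y\<in>sites L. h p y) = N"
      using big[OF p(2,3)] p(1) h_sum[of x \<zeta>] sum.remove[OF _ p(2), of "h p"] by (simp add: h_def)
    ultimately show "h p \<in> configs L N" by (simp add: configs_def)
  qed
  have hx: "h (x, \<zeta>) x > b" if "x \<in> sites L" "\<zeta> \<in> F x" for x \<zeta>
    using big[OF that] by (simp add: h_def)
  have hy: "h (x, \<zeta>) y \<le> b" if "x \<in> sites L" "\<zeta> \<in> F x" "y \<in> sites L" "y \<noteq> x" for x \<zeta> y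
    using F[OF that(1)] that(2,3,4) by (auto simp: h_def PiE_iff)
  have inj: "inj_on h ?D"
  proof (rule inj_onI)
    fix p q assume *: "p \<in> ?D" "q \<in> ?D" "h p = h q"
    obtain x \<zeta> where p: "p = (x, \<zeta>)" "x \<in> sites L" "\<zeta> \<in> F x" using *(1) by auto
    obtain y \<xi> where q: "q = (y, \<xi>)" "y \<in> sites L" "\<xi> \<in> F y" using *(2) by auto
    \<comment> \<open>The site that received the missing particles is the only one above
      \<open>b\<close>.\<close>
    have xy: "x = y"
      using hx[OF p(2,3)] hy[OF q(2,3) p(2)] *(3) p(1) q(1) by force
    have "\<zeta> z = \<xi> z" if "z \<in> sites L - {x}" for z
      using fun_cong[OF *(3), of z] that p(1) q(1) xy by (simp add: h_def)
    then have "\<zeta> = \<xi>"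
      using subsetD[OF F[OF p(2)] p(3)] subsetD[OF F[OF q(2)] q(3)] xy by (intro PiE_ext) auto
    then show "p = q" using p q xy by simp
  qed
  have nonneg: "(\<Prod>y\<in>A. W (\<eta> y)) \<ge> 0" if "\<And>y. y \<in> A \<Longrightarrow> \<eta> y \<le> N" for A and \<eta> :: config
    using that W by (intro prod_nonneg) auto
  have cN: "\<eta> y \<le> N" if "\<eta> \<in> configs L N" "y \<in> sites L" for \<eta> y
    using that member_le_sum[of y "sites L" \<eta>] by (auto simp: configs_def)
  have "(\<Sum>x\<in>sites L. m * mass W (sites L - {x}) (F x))
      = (\<Sum>x\<in>sites L. \<Sum>\<zeta>\<in>F x. m * (\<Prod>y\<in>sites L - {x}. W (\<zeta> y)))"
    by (simp add: mass_def sum_distrib_left)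
  also have "\<dots> \<le> (\<Sum>x\<in>sites L. \<Sum>\<zeta>\<in>F x. \<Prod>y\<in>sites L. W (h (x, \<zeta>) y))"
  proof (intro sum_mono)
    fix x \<zeta> assume x: "x \<in> sites L" "\<zeta> \<in> F x"
    have "(\<Prod>y\<in>sites L. W (h (x, \<zeta>) y)) = W (N - ?S x \<zeta>) * (\<Prod>y\<in>sites L - {x}. W (h (x, \<zeta>) y))"
      using prod.remove[OF _ x(1), of "\<lambda>y. W (h (x, \<zeta>) y)"] by (simp add: h_def)
    also have "(\<Prod>y\<in>sites L - {x}. W (h (x, \<zeta>) y)) = (\<Prod>y\<in>sites L - {x}. W (\<zeta> y))"
      by (intro prod.cong) (auto simp: h_def)
    also have "W (N - ?S x \<zeta>) * \<dots> \<ge> m * (\<Prod>y\<in>sites L - {x}. W (\<zeta> y))"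
    proof (rule mult_right_mono[OF m[OF x]])
      have "\<zeta> y \<le> N" if "y \<in> sites L - {x}" for y
        using hy[OF x, of y] that \<open>b \<le> N\<close> by (auto simp: h_def)
      then show "(\<Prod>y\<in>sites L - {x}. W (\<zeta> y)) \<ge> 0" by (intro nonneg)
    qed
    finally show "m * (\<Prod>y\<in>sites L - {x}. W (\<zeta> y)) \<le> (\<Prod>y\<in>sites L. W (h (x, \<zeta>) y))" .
  qed
  also have "\<dots> = (\<Sum>\<eta>\<in>h ` ?D. \<Prod>y\<in>sites L. W (\<eta> y))"
    using finF by (subst sum.reindex[OF inj]) (simp add: sum.Sigma case_prod_unfold del: One_nat_def)
  also have "\<dots> \<le> partition_fun W L N"
    unfolding partition_fun_def using img cN
    by (intro sum_mono2 finite_configs nonneg) auto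
  finally show ?thesis .
qed

subsection \<open>Large deviations of the bulk\<close>

text \<open>Bounds by the values at both ends that hold for either sign of \<kappa>; the sum stands
  in for the maximum.\<close>

lemma powr_between:
  fixes x :: real
  assumes "0 < a" "a \<le> x" "x \<le> c"
  shows "min (a powr \<kappa>) (c powr \<kappa>) \<le> x powr \<kappa>" "x powr \<kappa> \<le> a powr \<kappa> + c powr \<kappa>"
proof -
  have "a powr \<kappa> \<le> x powr \<kappa> \<and> x powr \<kappa> \<le> c powr \<kappa> \<or> c powr \<kappa> \<le> x powr \<kappa> \<and> x powr \<kappa> \<le> a powr \<kappa>"
  proof (cases "\<kappa> \<ge> 0")
    case True
    then show ?thesis using assms by (intro disjI1 conjI powr_mono2) auto
  next
    case False
    then show ?thesis using assms by (intro disjI2 conjI powr_mono2') auto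
  qed
  then show "min (a powr \<kappa>) (c powr \<kappa>) \<le> x powr \<kappa>" "x powr \<kappa> \<le> a powr \<kappa> + c powr \<kappa>"
    using powr_ge_zero[of a \<kappa>] powr_ge_zero[of c \<kappa>] by linarith+
qed

section \<open>Standing assumptions and the tilted one-site total\<close>

text \<open>The parameter \<phi> is one point strictly between 1 and the threshold of convergence;
  it carries the exponential moments of \<open>w\<close>.\<close>

locale condensation =
  fixes w :: "nat \<Rightarrow> real" and wL \<delta> :: "nat \<Rightarrow> nat \<Rightarrow> real"
    and \<theta> \<gamma> \<kappa> \<rho> \<phi> :: real and N :: "nat \<Rightarrow> nat"
  assumes \<theta>_pos: "\<theta> > 0" and \<kappa>_gt: "\<kappa> > -1" and \<gamma>_gt: "\<gamma> > \<kappa> + 2"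
    and wL_form: "\<And>L n. L \<ge> 1 \<Longrightarrow>
          wL L n = w n + \<theta> / real L powr \<gamma> * (real n + 1) powr \<kappa> * (1 + \<delta> L n)"
    and wL_pos: "\<And>L n. L \<ge> 1 \<Longrightarrow> wL L n > 0"
    and \<delta>_small: "(\<lambda>L. real L * (SUP n\<in>{..N L}. \<bar>\<delta> L n\<bar>)) \<longlonglongrightarrow> 0"
    and w_nonneg: "\<And>n. w n \<ge> 0"
    and \<phi>_gt_1: "\<phi> > 1" and z_finite: "summable (\<lambda>n. w n * \<phi> ^ n)"
    and w_sums: "w sums 1"
    and \<rho>c_finite: "summable (\<lambda>n. real n * w n)"
    and density: "(\<lambda>L. real (N L) / real L) \<longlonglongrightarrow> \<rho>"
    and supercritical: "\<rho> > critical_density w"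
begin

abbreviation \<rho>c :: real where "\<rho>c \<equiv> critical_density w"

lemma \<rho>c_nonneg: "\<rho>c \<ge> 0"
  unfolding critical_density_def using \<rho>c_finite w_nonneg by (intro suminf_nonneg) auto

lemma \<rho>_pos: "\<rho> > 0"
  using \<rho>c_nonneg supercritical by linarith

lemma N_close:
  assumes "e > 0"
  shows "\<forall>\<^sub>F L in sequentially. \<bar>real (N L) - \<rho> * real L\<bar> \<le> e * real L"
  using tendstoD[OF density assms] eventually_gt_at_top[of 0]
proof eventually_elim
  case (elim L)
  then have "\<bar>real (N L) / real L - \<rho>\<bar> * real L \<le> e * real L"
    by (intro mult_right_mono) (auto simp: dist_real_def)
  also have "\<bar>real (N L) / real L - \<rho>\<bar> * real L = \<bar>(real (N L) / real L - \<rho>) * real L\<bar>"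
    by (simp add: abs_mult)
  also have "(real (N L) / real L - \<rho>) * real L = real (N L) - \<rho> * real L"
    using elim by (simp add: field_simps)
  finally show ?case .
qed

text \<open>Since \<open>L \<ge> 1\<close>, eventually
  \<open>\<bar>\<delta> L n\<bar> \<le> 1 / 2\<close>, so \<open>1 + \<delta> L n\<close> lies
  between 1/2 and 2. This control reaches only up to \<open>N L\<close>.\<close>

lemma wL_bounds:
  "\<forall>\<^sub>F L in sequentially. \<forall>n\<le>N L.
     w n + \<theta> / 2 * real L powr - \<gamma> * (real n + 1) powr \<kappa> \<le> wL L n \<and>
     wL L n \<le> w n + 2 * \<theta> * real L powr - \<gamma> * (real n + 1) powr \<kappa>"
proof -
  have "\<forall>\<^sub>F L in sequentially. real L * (SUP n\<in>{..N L}. \<bar>\<delta> L n\<bar>) < 1 / 2"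
    using \<delta>_small by (rule order_tendstoD) simp
  then show ?thesis using eventually_ge_at_top[of 1]
  proof eventually_elim
    case (elim L)
    show ?case
    proof (intro allI impI)
      fix n assume "n \<le> N L"
      then have le: "\<bar>\<delta> L n\<bar> \<le> (SUP n\<in>{..N L}. \<bar>\<delta> L n\<bar>)"
        by (intro cSUP_upper) auto
      then have "1 * (SUP n\<in>{..N L}. \<bar>\<delta> L n\<bar>) \<le> real L * (SUP n\<in>{..N L}. \<bar>\<delta> L n\<bar>)"
        using elim(2) by (intro mult_right_mono) auto
      then have "\<bar>\<delta> L n\<bar> \<le> 1 / 2" using le elim(1) by linarith
      then have \<delta>: "1 / 2 \<le> 1 + \<delta> L n" "1 + \<delta> L n \<le> 2" by linarith+
      define P where "P = \<theta> / real L powr \<gamma> * (real n + 1) powr \<kappa>"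
      have "P \<ge> 0" using \<theta>_pos by (simp add: P_def)
      then have "P * (1 / 2) \<le> P * (1 + \<delta> L n)" "P * (1 + \<delta> L n) \<le> P * 2"
        using \<delta> by (intro mult_left_mono; simp)+
      moreover have "wL L n = w n + P * (1 + \<delta> L n)"
        using wL_form[OF elim(2)] by (simp add: P_def)
      moreover have "\<theta> / 2 * real L powr - \<gamma> * (real n + 1) powr \<kappa> = P * (1 / 2)"
        "2 * \<theta> * real L powr - \<gamma> * (real n + 1) powr \<kappa> = P * 2"
        by (simp_all add: P_def powr_minus_divide)
      ultimately show "w n + \<theta> / 2 * real L powr - \<gamma> * (real n + 1) powr \<kappa> \<le> wL L n \<and>
          wL L n \<le> w n + 2 * \<theta> * real L powr - \<gamma> * (real n + 1) powr \<kappa>"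
        by linarith
    qed
  qed
qed

text \<open>Keeps the truncation level inside the range where the weights are controlled.\<close>

lemma trunc_le_N:
  assumes "a < \<rho>" "a > 0"
  shows "\<forall>\<^sub>F L in sequentially. nat \<lfloor>a * real L\<rfloor> \<le> N L"
proof (rule eventually_mono[OF N_close[of "\<rho> - a"]])
  fix L assume "\<bar>real (N L) - \<rho> * real L\<bar> \<le> (\<rho> - a) * real L"
  then have "a * real L \<le> real (N L)" by (auto simp: algebra_simps)
  then show "nat \<lfloor>a * real L\<rfloor> \<le> N L" by linarith
qed (use assms in simp)

text \<open>The tilt \<open>s\<close> is of order \<open>ln L / L\<close>, so that it costs the perturbation only a factor
  \<open>L powr (C * a)\<close>, which is absorbed by the gap \<open>\<gamma> - (\<kappa> + 2)\<close>.\<close>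

lemma tilted_total_le:
  assumes "C > 0" "0 < a" "a < \<rho>" "C * a \<le> (\<gamma> - \<kappa> - 2) / 2"
  shows "\<forall>\<^sub>F L in sequentially. \<forall>s. \<bar>s\<bar> = C * ln (real L) / real L \<longrightarrow>
    (\<Sum>n\<le>nat \<lfloor>a * real L\<rfloor>. wL L n * exp (s * real n)) \<le> exp (s * \<rho>c + 1 / real L)"
proof -
  obtain r K where rK: "r > 0" "K > 0"
    "\<And>s b. \<bar>s\<bar> \<le> r \<Longrightarrow> (\<Sum>n\<le>b. w n * exp (s * real n)) \<le> 1 + s * \<rho>c + K * s\<^sup>2"
    using exp_moment_bounds[OF w_nonneg w_sums \<rho>c_finite \<phi>_gt_1 z_finite]
    unfolding critical_density_def by metis
  define d where "d = \<gamma> - \<kappa> - 2"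
  have d: "d > 0" using \<gamma>_gt by (simp add: d_def)
  define c where "c = 2 * \<theta> * ((a + 1) powr (\<kappa> + 1) / min 1 (\<kappa> + 1))"
  have ev1: "\<forall>\<^sub>F L in sequentially. C * ln (real L) / real L \<le> r"
    using rK(1) by real_asymp
  \<comment> \<open>The quadratic term is of order \<open>(ln L / L)\<^sup>2\<close>, and the
    perturbation has one power of \<open>L\<close> to spare beyond \<open>1 / L\<close> up to the
    remaining exponent: both are o(1 / L). An error \<open>1 / L\<close> per site is what a product
    over at most \<open>L\<close> sites tolerates.\<close>
  have ev2: "\<forall>\<^sub>F L in sequentially. K * (C * ln (real L) / real L)\<^sup>2 + c * real L powr (- 1 - d / 2) \<le> 1 / real L"
  proof -
    have "(\<lambda>L. real L * (C * ln (real L) / real L)\<^sup>2) \<longlonglongrightarrow> 0" using assms(1) by real_asymp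
    moreover have "(\<lambda>L. real L * real L powr (- 1 - d / 2)) \<longlonglongrightarrow> 0" using d by real_asymp
    ultimately have "(\<lambda>L. K * (real L * (C * ln (real L) / real L)\<^sup>2) + c * (real L * real L powr (- 1 - d / 2)))
        \<longlonglongrightarrow> K * 0 + c * 0"
      by (intro tendsto_intros)
    then have "\<forall>\<^sub>F L in sequentially.
        K * (real L * (C * ln (real L) / real L)\<^sup>2) + c * (real L * real L powr (- 1 - d / 2)) < 1"
      by (rule order_tendstoD) simp
    then show ?thesis
      using eventually_gt_at_top[of 0]
    proof eventually_elim
      case (elim L)
      have "(K * (C * ln (real L) / real L)\<^sup>2 + c * real L powr (- 1 - d / 2)) * real L
          = K * (real L * (C * ln (real L) / real L)\<^sup>2) + c * (real L * real L powr (- 1 - d / 2))"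
        by (simp only: distrib_left distrib_right ac_simps)
      then have "(K * (C * ln (real L) / real L)\<^sup>2 + c * real L powr (- 1 - d / 2)) * real L \<le> 1"
        using elim(1) by simp
      then show ?case using elim(2) by (simp only: pos_le_divide_eq of_nat_0_less_iff)
    qed
  qed
  show ?thesis
    using ev1 ev2 wL_bounds trunc_le_N[OF assms(3,2)] eventually_ge_at_top[of 1]
  proof eventually_elim
    case (elim L)
    define b where "b = nat \<lfloor>a * real L\<rfloor>"
    have b: "real b \<le> a * real L" using assms(2) by (simp add: b_def)
    have L: "real L \<ge> 1" using elim(5) by simp
    show ?case
    proof (intro allI impI)
      fix s assume s: "\<bar>s\<bar> = C * ln (real L) / real L"
      have exp_le: "exp (s * real n) \<le> real L powr (d / 2)" if "n \<le> b" for n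
      proof -
        have "s * real n \<le> \<bar>s\<bar> * real n" by (rule mult_right_mono) simp_all
        also have "\<dots> \<le> \<bar>s\<bar> * (a * real L)"
          using that b by (intro mult_left_mono) linarith+
        also have "\<dots> = C * a * ln (real L)" using L s by simp
        also have "\<dots> \<le> d / 2 * ln (real L)"
          using assms(4) L by (intro mult_right_mono) (auto simp: d_def)
        finally show ?thesis using L by (simp add: powr_def)
      qed
      have "(\<Sum>n\<le>b. wL L n * exp (s * real n))
          \<le> (\<Sum>n\<le>b. w n * exp (s * real n) + 2 * \<theta> * real L powr - \<gamma> * real L powr (d / 2) * (real n + 1) powr \<kappa>)"
      proof (rule sum_mono)
        fix n assume "n \<in> {..b}"
        then have n: "n \<le> b" "n \<le> N L" using elim(4) by (auto simp: b_def)
        have "wL L n * exp (s * real n)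
            \<le> (w n + 2 * \<theta> * real L powr - \<gamma> * (real n + 1) powr \<kappa>) * exp (s * real n)"
          using elim(3) n by (intro mult_right_mono) auto
        also have "\<dots> = w n * exp (s * real n) + 2 * \<theta> * real L powr - \<gamma> * (real n + 1) powr \<kappa> * exp (s * real n)"
          by (rule distrib_right)
        also have "2 * \<theta> * real L powr - \<gamma> * (real n + 1) powr \<kappa> * exp (s * real n)
            \<le> 2 * \<theta> * real L powr - \<gamma> * (real n + 1) powr \<kappa> * real L powr (d / 2)"
          using exp_le[OF n(1)] \<theta>_pos by (intro mult_left_mono) auto
        finally show "wL L n * exp (s * real n)
            \<le> w n * exp (s * real n) + 2 * \<theta> * real L powr - \<gamma> * real L powr (d / 2) * (real n + 1) powr \<kappa>"
          by (simp only: ac_simps)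
      qed
      also have "\<dots> = (\<Sum>n\<le>b. w n * exp (s * real n))
          + 2 * \<theta> * real L powr - \<gamma> * real L powr (d / 2) * (\<Sum>n\<le>b. (real n + 1) powr \<kappa>)"
        by (simp add: sum.distrib sum_distrib_left)
      also have "\<dots> \<le> (1 + s * \<rho>c + K * s\<^sup>2) + c * real L powr (- 1 - d / 2)"
      proof (rule add_mono)
        show "(\<Sum>n\<le>b. w n * exp (s * real n)) \<le> 1 + s * \<rho>c + K * s\<^sup>2"
          using rK(3) s elim(1) by simp
        have "(\<Sum>n\<le>b. (real n + 1) powr \<kappa>) \<le> (real b + 1) powr (\<kappa> + 1) / min 1 (\<kappa> + 1)"
          using \<kappa>_gt by (rule sum_powr_le)
        also have "(real b + 1) powr (\<kappa> + 1) \<le> ((a + 1) * real L) powr (\<kappa> + 1)"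
          using b L \<kappa>_gt by (intro powr_mono2) (auto simp: algebra_simps)
        finally have le: "(\<Sum>n\<le>b. (real n + 1) powr \<kappa>) \<le> (a + 1) powr (\<kappa> + 1) / min 1 (\<kappa> + 1) * real L powr (\<kappa> + 1)"
          using \<kappa>_gt assms(2) by (simp add: powr_mult divide_right_mono)
        have "2 * \<theta> * real L powr - \<gamma> * real L powr (d / 2) * (\<Sum>n\<le>b. (real n + 1) powr \<kappa>)
            \<le> 2 * \<theta> * real L powr - \<gamma> * real L powr (d / 2) *
              ((a + 1) powr (\<kappa> + 1) / min 1 (\<kappa> + 1) * real L powr (\<kappa> + 1))"
          using le \<theta>_pos by (intro mult_left_mono) auto
        also have "\<dots> = c * (real L powr - \<gamma> * real L powr (d / 2) * real L powr (\<kappa> + 1))"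
          by (simp add: c_def)
        also have "real L powr - \<gamma> * real L powr (d / 2) * real L powr (\<kappa> + 1) = real L powr (- \<gamma> + d / 2 + (\<kappa> + 1))"
          by (simp only: powr_add)
        \<comment> \<open>Half of the gap \<open>d\<close> is spent on the tilt, the other half is
          left as decay beyond \<open>1 / L\<close>.\<close>
        also have "- \<gamma> + d / 2 + (\<kappa> + 1) = - 1 - d / 2" by (simp add: d_def field_simps)
        finally show "2 * \<theta> * real L powr - \<gamma> * real L powr (d / 2) * (\<Sum>n\<le>b. (real n + 1) powr \<kappa>)
            \<le> c * real L powr (- 1 - d / 2)" .
      qed
      also have "K * s\<^sup>2 = K * (C * ln (real L) / real L)\<^sup>2"
        by (simp flip: s)
      also have "1 + s * \<rho>c + K * (C * ln (real L) / real L)\<^sup>2 + c * real L powr (- 1 - d / 2) \<le> 1 + (s * \<rho>c + 1 / real L)"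
        using elim(2) by linarith
      also have "\<dots> \<le> exp (s * \<rho>c + 1 / real L)" by (rule exp_ge_add_one_self)
      finally show "(\<Sum>n\<le>nat \<lfloor>a * real L\<rfloor>. wL L n * exp (s * real n)) \<le> exp (s * \<rho>c + 1 / real L)"
        by (simp add: b_def)
    qed
  qed
qed

section \<open>Fluctuations of the particle number without large sites\<close>

text \<open>The centre is \<open>\<rho>c * L\<close> even when \<open>A\<close> has
  \<open>L - 1\<close> sites, since one site shifts the mean only by a bounded amount. With the
  strict inequality here and the weak one in \<open>atypical\<close>, the two sets partition the
  truncated box.\<close>

definition typical :: "'a set \<Rightarrow> real \<Rightarrow> real \<Rightarrow> nat \<Rightarrow> ('a \<Rightarrow> nat) set" where
  "typical A a e L = {\<zeta> \<in> A \<rightarrow>\<^sub>E {..nat \<lfloor>a * real L\<rfloor>}. \<bar>real (\<Sum>x\<in>A. \<zeta> x) - \<rho>c * real L\<bar> < e * real L}"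

definition atypical :: "'a set \<Rightarrow> real \<Rightarrow> real \<Rightarrow> nat \<Rightarrow> ('a \<Rightarrow> nat) set" where
  "atypical A a e L = {\<zeta> \<in> A \<rightarrow>\<^sub>E {..nat \<lfloor>a * real L\<rfloor>}. e * real L \<le> \<bar>real (\<Sum>x\<in>A. \<zeta> x) - \<rho>c * real L\<bar>}"

lemma finite_trunc: "finite A \<Longrightarrow> finite (A \<rightarrow>\<^sub>E {..b::nat})"
  by (intro finite_PiE) auto

lemma finite_atypical: "finite A \<Longrightarrow> finite (atypical A a e L)"
  unfolding atypical_def by (rule finite_subset[OF _ finite_trunc]) auto

text \<open>With \<open>C = (p + 1) / e\<close>, a deviation \<open>e * L\<close> at tilt
  \<open>C * ln L / L\<close> costs \<open>L powr - (p + 1)\<close>; the extra power absorbs the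
  constant \<open>2 * exp 2\<close>. Uniformity in \<open>A\<close> is needed because both the full
  set of sites and the sets with one site removed occur.\<close>

lemma atypical_mass_le:
  assumes e: "e > 0" and p: "p \<ge> 0" and a: "0 < a" "a < \<rho>" "(p + 1) / e * a \<le> (\<gamma> - \<kappa> - 2) / 2"
  shows "\<forall>\<^sub>F L in sequentially. \<forall>A :: 'a set. finite A \<longrightarrow> L - 1 \<le> card A \<longrightarrow> card A \<le> L \<longrightarrow>
    mass (wL L) A (atypical A a e L) \<le> real L powr - p"
proof -
  define C where "C = (p + 1) / e"
  have C: "C > 0" using e p by (simp add: C_def)
  have Ce: "C * e = p + 1" using e by (simp add: C_def)
  have ev1: "\<forall>\<^sub>F L in sequentially. C * ln (real L) / real L * \<rho>c \<le> 1"
  proof -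
    have "(\<lambda>L. C * ln (real L) / real L) \<longlonglongrightarrow> 0" by real_asymp
    then have "(\<lambda>L. C * ln (real L) / real L * \<rho>c) \<longlonglongrightarrow> 0 * \<rho>c" by (intro tendsto_intros)
    then have "\<forall>\<^sub>F L in sequentially. C * ln (real L) / real L * \<rho>c < 1"
      by (rule order_tendstoD) simp
    then show ?thesis by eventually_elim simp
  qed
  have ev2: "\<forall>\<^sub>F L in sequentially. 2 * exp 2 \<le> real L"
    by real_asymp
  show ?thesis
    using tilted_total_le[OF C a(1,2) a(3)[folded C_def]] ev1 ev2 eventually_ge_at_top[of 1]
  proof eventually_elim
    case (elim L)
    define b where "b = nat \<lfloor>a * real L\<rfloor>"
    have L: "real L \<ge> 1" using elim(4) by simp
    show ?case
    proof (intro allI impI)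
      fix A :: "'a set" assume A: "finite A" "L - 1 \<le> card A" "card A \<le> L"
      have cA: "real L - 1 \<le> real (card A)" "real (card A) \<le> real L" using A elim(4) by linarith+
      have W: "wL L n \<ge> 0" for n using wL_pos[OF elim(4)] by (rule less_imp_le)
      have side: "mass (wL L) A {\<zeta> \<in> A \<rightarrow>\<^sub>E {..b}. s * \<rho>c * real L + C * e * ln (real L) \<le> s * real (\<Sum>x\<in>A. \<zeta> x)}
          \<le> exp 2 * real L powr - (p + 1)" if s: "\<bar>s\<bar> = C * ln (real L) / real L" for s
      proof -
        have "mass (wL L) A {\<zeta> \<in> A \<rightarrow>\<^sub>E {..b}. s * \<rho>c * real L + C * e * ln (real L) \<le> s * real (\<Sum>x\<in>A. \<zeta> x)}
          \<le> exp (- (s * \<rho>c * real L + C * e * ln (real L))) * (\<Sum>n\<le>b. wL L n * exp (s * real n)) ^ card A"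
          using A(1) W by (intro mass_chernoff) auto
        also have "\<dots> \<le> exp (- (s * \<rho>c * real L + C * e * ln (real L))) * exp (s * \<rho>c + 1 / real L) ^ card A"
          using elim(1) s W by (intro mult_left_mono power_mono sum_nonneg) (auto simp: b_def)
        also have "\<dots> = exp (- (s * \<rho>c * real L + C * e * ln (real L)) + real (card A) * (s * \<rho>c + 1 / real L))"
          by (simp only: exp_of_nat_mult exp_add)
        \<comment> \<open>One unit of the 2 comes from \<open>card A\<close> missing
          \<open>L\<close> by at most one site, the other from the error \<open>1 / L\<close>
          accumulated over the sites.\<close>
        also have "\<dots> \<le> exp (2 - (p + 1) * ln (real L))"
        proof -
          have "(real (card A) - real L) * (s * \<rho>c) \<le> \<bar>(real (card A) - real L) * (s * \<rho>c)\<bar>" by simp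
          also have "\<dots> = \<bar>real (card A) - real L\<bar> * (\<bar>s\<bar> * \<rho>c)" using \<rho>c_nonneg by (simp add: abs_mult)
          also have "\<dots> \<le> 1 * (\<bar>s\<bar> * \<rho>c)"
            using cA \<rho>c_nonneg by (intro mult_right_mono) auto
          also have "\<dots> \<le> 1" using elim(2) s by simp
          finally have "real (card A) * (s * \<rho>c) \<le> s * \<rho>c * real L + 1"
            by (simp add: algebra_simps)
          moreover have "real (card A) * (1 / real L) \<le> 1" using cA L by simp
          ultimately show ?thesis by (simp add: Ce distrib_left)
        qed
        also have "\<dots> = exp 2 * real L powr - (p + 1)"
          using L by (simp add: powr_def algebra_simps flip: exp_add)
        finally show ?thesis .
      qed
      define s where "s = C * ln (real L) / real L"
      have s: "\<bar>s\<bar> = C * ln (real L) / real L" "\<bar>- s\<bar> = C * ln (real L) / real L" "s \<ge> 0"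
        using C L by (auto simp: s_def)
      have sL: "C * e * ln (real L) = s * (e * real L)" using L by (simp add: s_def)
      let ?U = "\<lambda>s. {\<zeta> \<in> A \<rightarrow>\<^sub>E {..b}. s * \<rho>c * real L + C * e * ln (real L) \<le> s * real (\<Sum>x\<in>A. \<zeta> x)}"
      have "atypical A a e L \<subseteq> ?U s \<union> ?U (- s)"
      proof
        fix \<zeta> assume "\<zeta> \<in> atypical A a e L"
        then have \<zeta>: "\<zeta> \<in> A \<rightarrow>\<^sub>E {..b}" "e * real L \<le> \<bar>real (\<Sum>x\<in>A. \<zeta> x) - \<rho>c * real L\<bar>"
          by (auto simp: atypical_def b_def)
        define S where "S = real (\<Sum>x\<in>A. \<zeta> x)"
        have "s * (e * real L) \<le> s * \<bar>S - \<rho>c * real L\<bar>"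
          using \<zeta>(2) s(3) unfolding S_def by (rule mult_left_mono)
        then have "s * \<rho>c * real L + s * (e * real L) \<le> s * S \<or> - s * \<rho>c * real L + s * (e * real L) \<le> - s * S"
          by (cases "S \<ge> \<rho>c * real L") (simp_all add: algebra_simps)
        then show "\<zeta> \<in> ?U s \<union> ?U (- s)" using \<zeta>(1) unfolding sL S_def by blast
      qed
      then have "mass (wL L) A (atypical A a e L) \<le> mass (wL L) A (?U s \<union> ?U (- s))"
        using A(1) W by (intro mass_mono finite_UnI finite_subset[OF _ finite_trunc[OF A(1)]]) auto
      also have "\<dots> \<le> mass (wL L) A (?U s) + mass (wL L) A (?U (- s))"
        using A(1) W by (intro mass_Un_le finite_subset[OF _ finite_trunc[OF A(1)]]) auto
      also have "\<dots> \<le> 2 * exp 2 * real L powr - (p + 1)"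
        using side[OF s(1)] side[OF s(2)] by simp
      also have "\<dots> \<le> real L * real L powr - (p + 1)"
        using elim(3) by (intro mult_right_mono) auto
      also have "\<dots> = real L powr (1 + - (p + 1))"
        using L by (simp only: powr_add) simp
      finally show "mass (wL L) A (atypical A a e L) \<le> real L powr - p" by simp
    qed
  qed
qed

text \<open>The truncated box has nearly full mass: \<open>wL\<close> dominates \<open>w\<close>,
  whose tail beyond \<open>a * L\<close> is some \<open>t\<close> of order
  \<open>L powr - 2\<close>, and Bernoulli's inequality gives
  \<open>(1 - t) ^ card A \<ge> 1 - L * t\<close>. Removing the atypical part leaves more than one
  half.\<close>

lemma typical_mass_ge:
  assumes e: "e > 0" and p: "p > 0" and a: "0 < a" "a < \<rho>" "(p + 1) / e * a \<le> (\<gamma> - \<kappa> - 2) / 2"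
  shows "\<forall>\<^sub>F L in sequentially. \<forall>A :: 'a set. finite A \<longrightarrow> L - 1 \<le> card A \<longrightarrow> card A \<le> L \<longrightarrow>
    1 / 2 \<le> mass (wL L) A (typical A a e L)"
proof -
  obtain K where K: "K > 0" "\<And>b. 1 - K / (real b + 1)\<^sup>2 \<le> (\<Sum>n\<le>b. w n)"
    using exp_moment_bounds[OF w_nonneg w_sums \<rho>c_finite \<phi>_gt_1 z_finite] by metis
  have ev1: "\<forall>\<^sub>F L in sequentially. K / (a * real L)\<^sup>2 \<le> 1"
    using K(1) a(1) by real_asymp
  have ev2: "\<forall>\<^sub>F L in sequentially. real L * (K / (a * real L)\<^sup>2) + real L powr - p \<le> 1 / 2"
  proof -
    have "(\<lambda>L. real L * (K / (a * real L)\<^sup>2)) \<longlonglongrightarrow> 0" using K(1) a(1) by real_asymp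
    moreover have "(\<lambda>L. real L powr - p) \<longlonglongrightarrow> 0" using p by real_asymp
    ultimately have "(\<lambda>L. real L * (K / (a * real L)\<^sup>2) + real L powr - p) \<longlonglongrightarrow> 0 + 0"
      by (intro tendsto_intros)
    then have "\<forall>\<^sub>F L in sequentially. real L * (K / (a * real L)\<^sup>2) + real L powr - p < 1 / 2"
      by (rule order_tendstoD) simp
    then show ?thesis by eventually_elim simp
  qed
  show ?thesis
    using ev1 ev2 atypical_mass_le[where 'a = 'a, OF e less_imp_le[OF p] a] wL_bounds trunc_le_N[OF a(2,1)] eventually_ge_at_top[of 1]
  proof eventually_elim
    case (elim L)
    define b where "b = nat \<lfloor>a * real L\<rfloor>"
    have W: "wL L n \<ge> 0" for n using wL_pos[OF elim(6)] by (rule less_imp_le)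
    have aL: "a * real L > 0" using a elim(6) by simp
    show ?case
    proof (intro allI impI)
      fix A :: "'a set" assume A: "finite A" "L - 1 \<le> card A" "card A \<le> L"
      define t where "t = K / (a * real L)\<^sup>2"
      have t: "0 \<le> t" "t \<le> 1" using K(1) elim(1) by (auto simp: t_def)
      have ab: "a * real L \<le> real b + 1" unfolding b_def by linarith
      have "(a * real L)\<^sup>2 \<le> (real b + 1)\<^sup>2" using ab aL by (intro power_mono) auto
      then have "K / (real b + 1)\<^sup>2 \<le> t"
        unfolding t_def using aL K(1) ab by (simp add: divide_left_mono zero_less_mult_iff)
      then have "1 - t \<le> (\<Sum>n\<le>b. w n)" using K(2)[of b] by linarith
      also have "\<dots> \<le> (\<Sum>n\<le>b. wL L n)"
      proof (rule sum_mono)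
        fix n assume "n \<in> {..b}"
        then have "w n + \<theta> / 2 * real L powr - \<gamma> * (real n + 1) powr \<kappa> \<le> wL L n"
          using elim(4,5) by (auto simp: b_def)
        moreover have "\<theta> / 2 * real L powr - \<gamma> * (real n + 1) powr \<kappa> \<ge> 0" using \<theta>_pos by simp
        ultimately show "w n \<le> wL L n" by linarith
      qed
      finally have "(1 - t) ^ card A \<le> (\<Sum>n\<le>b. wL L n) ^ card A"
        using t by (intro power_mono) auto
      also have "\<dots> = mass (wL L) A (A \<rightarrow>\<^sub>E {..b})"
        using A(1) by (simp add: mass_PiE)
      also have "\<dots> \<le> mass (wL L) A (typical A a e L \<union> atypical A a e L)"
        using A(1) W
        by (intro mass_mono finite_subset[OF _ finite_trunc[OF A(1), of b]]) (auto simp: typical_def atypical_def b_def)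
      also have "\<dots> \<le> mass (wL L) A (typical A a e L) + mass (wL L) A (atypical A a e L)"
        using A(1) W
        by (intro mass_Un_le finite_subset[OF _ finite_trunc[OF A(1), of b]]) (auto simp: typical_def atypical_def b_def)
      also have "mass (wL L) A (atypical A a e L) \<le> real L powr - p"
        using elim(3) A by blast
      finally have 1: "(1 - t) ^ card A \<le> mass (wL L) A (typical A a e L) + real L powr - p" by simp
      have "1 - real L * t \<le> 1 - real (card A) * t" using A(3) t by (simp add: mult_right_mono)
      also have "\<dots> \<le> (1 - t) ^ card A" using Bernoulli_inequality[of "- t" "card A"] t by simp
      finally show "1 / 2 \<le> mass (wL L) A (typical A a e L)"
        using 1 elim(2) unfolding t_def by linarith
    qed
  qed
qed

section \<open>Weights at occupations of order \<open>L\<close> and the untilted one-site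
  total\<close>

text \<open>After division by \<open>L\<close> the base lies between \<open>a\<close> and
  \<open>\<rho> + 2\<close>: one unit of slack covers the error of \<open>N L / L\<close>, the other
  the \<open>+ 1\<close> in the base.\<close>

lemma scaled_powr_bounds:
  assumes "0 < a"
  shows "\<forall>\<^sub>F L in sequentially. \<forall>n\<le>N L. a * real L \<le> real n + 1 \<longrightarrow>
    min (a powr \<kappa>) ((\<rho> + 2) powr \<kappa>) * real L powr \<kappa> \<le> (real n + 1) powr \<kappa> \<and>
    (real n + 1) powr \<kappa> \<le> (a powr \<kappa> + (\<rho> + 2) powr \<kappa>) * real L powr \<kappa>"
  using N_close[of 1, simplified] eventually_ge_at_top[of 1]
proof eventually_elim
  case (elim L)
  show ?case
  proof (intro allI impI)
    fix n assume n: "n \<le> N L" "a * real L \<le> real n + 1"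
    have L: "real L \<ge> 1" using elim(2) by simp
    have x: "a \<le> (real n + 1) / real L" "(real n + 1) / real L \<le> \<rho> + 2"
      using n elim(1) L by (auto simp: field_simps)
    have "(real n + 1) powr \<kappa> = ((real n + 1) / real L) powr \<kappa> * real L powr \<kappa>"
      using L by (simp flip: powr_mult)
    then show "min (a powr \<kappa>) ((\<rho> + 2) powr \<kappa>) * real L powr \<kappa> \<le> (real n + 1) powr \<kappa> \<and>
      (real n + 1) powr \<kappa> \<le> (a powr \<kappa> + (\<rho> + 2) powr \<kappa>) * real L powr \<kappa>"
      using powr_between[OF assms x, of \<kappa>] by (auto intro!: mult_right_mono)
  qed
qed

text \<open>Beyond \<open>a * L\<close> the bulk weight is exponentially small, so only the
  perturbation counts, and the weight is of order \<open>L powr (\<kappa> - \<gamma>)\<close>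
  uniformly over this range. The summand 1 in \<open>M\<close> swallows the bulk part.\<close>

lemma wL_large_bounds:
  assumes a: "0 < a"
  obtains m M where "m > 0" "M > 0"
    "\<forall>\<^sub>F L in sequentially. \<forall>n\<le>N L. a * real L \<le> real n \<longrightarrow>
       m * real L powr (\<kappa> - \<gamma>) \<le> wL L n \<and> wL L n \<le> M * real L powr (\<kappa> - \<gamma>)"
proof -
  obtain r K where rK: "r > 0" "K > 0" "\<And>n. w n \<le> K * exp (- r * real n)"
    using exp_moment_bounds[OF w_nonneg w_sums \<rho>c_finite \<phi>_gt_1 z_finite] by metis
  define m where "m = \<theta> / 2 * min (a powr \<kappa>) ((\<rho> + 2) powr \<kappa>)"
  define M where "M = 1 + 2 * \<theta> * (a powr \<kappa> + (\<rho> + 2) powr \<kappa>)"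
  have ev: "\<forall>\<^sub>F L in sequentially. K * exp (- r * (a * real L)) \<le> real L powr (\<kappa> - \<gamma>)"
    using rK(1) a by real_asymp
  have "\<forall>\<^sub>F L in sequentially. \<forall>n\<le>N L. a * real L \<le> real n \<longrightarrow>
       m * real L powr (\<kappa> - \<gamma>) \<le> wL L n \<and> wL L n \<le> M * real L powr (\<kappa> - \<gamma>)"
    using ev scaled_powr_bounds[OF a] wL_bounds
  proof eventually_elim
    case (elim L)
    show ?case
    proof (intro allI impI)
      fix n assume n: "n \<le> N L" "a * real L \<le> real n"
      have B: "min (a powr \<kappa>) ((\<rho> + 2) powr \<kappa>) * real L powr \<kappa> \<le> (real n + 1) powr \<kappa>"
        "(real n + 1) powr \<kappa> \<le> (a powr \<kappa> + (\<rho> + 2) powr \<kappa>) * real L powr \<kappa>"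
        using elim(2) n by auto
      have pw: "real L powr (\<kappa> - \<gamma>) = real L powr - \<gamma> * real L powr \<kappa>"
        by (simp flip: powr_add)
      have "\<theta> / 2 * real L powr - \<gamma> * (min (a powr \<kappa>) ((\<rho> + 2) powr \<kappa>) * real L powr \<kappa>)
          \<le> \<theta> / 2 * real L powr - \<gamma> * (real n + 1) powr \<kappa>"
        using B(1) \<theta>_pos by (intro mult_left_mono) auto
      then have 1: "m * real L powr (\<kappa> - \<gamma>) \<le> \<theta> / 2 * real L powr - \<gamma> * (real n + 1) powr \<kappa>"
        unfolding m_def pw by (simp only: ac_simps)
      have "2 * \<theta> * real L powr - \<gamma> * (real n + 1) powr \<kappa>
          \<le> 2 * \<theta> * real L powr - \<gamma> * ((a powr \<kappa> + (\<rho> + 2) powr \<kappa>) * real L powr \<kappa>)"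
        using B(2) \<theta>_pos by (intro mult_left_mono) auto
      also have "\<dots> = (M - 1) * real L powr (\<kappa> - \<gamma>)"
        unfolding M_def pw by (simp add: ac_simps)
      finally have 2: "2 * \<theta> * real L powr - \<gamma> * (real n + 1) powr \<kappa> \<le> (M - 1) * real L powr (\<kappa> - \<gamma>)" .
      have "w n \<le> K * exp (- r * real n)" by (rule rK(3))
      also have "\<dots> \<le> K * exp (- r * (a * real L))"
        using rK n(2) by (intro mult_left_mono) (auto simp: mult_left_mono)
      also have "\<dots> \<le> real L powr (\<kappa> - \<gamma>)" by (rule elim(1))
      finally have 3: "w n \<le> real L powr (\<kappa> - \<gamma>)" .
      have 4: "w n + \<theta> / 2 * real L powr - \<gamma> * (real n + 1) powr \<kappa> \<le> wL L n"
        "wL L n \<le> w n + 2 * \<theta> * real L powr - \<gamma> * (real n + 1) powr \<kappa>"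
        using elim(3) n(1) by auto
      show "m * real L powr (\<kappa> - \<gamma>) \<le> wL L n \<and> wL L n \<le> M * real L powr (\<kappa> - \<gamma>)"
        using 1 2 3 4 w_nonneg[of n] by (simp add: left_diff_distrib)
    qed
  qed
  moreover have "m > 0" "M > 0" using \<theta>_pos a \<rho>_pos by (auto simp: m_def M_def intro!: add_pos_nonneg)
  ultimately show ?thesis using that by blast
qed

text \<open>Without truncation the perturbation still adds only o(1 / L) per site, so that sites
  left unconstrained contribute a bounded factor altogether.\<close>

lemma total_le: "\<forall>\<^sub>F L in sequentially. (\<Sum>n\<le>N L. wL L n) \<le> 1 + 1 / real L"
proof -
  define d where "d = \<gamma> - \<kappa> - 2"
  have d: "d > 0" using \<gamma>_gt by (simp add: d_def)
  define c where "c = 2 * \<theta> * ((\<rho> + 2) powr (\<kappa> + 1) / min 1 (\<kappa> + 1))"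
  have "\<forall>\<^sub>F L in sequentially. c * real L powr (- 1 - d) \<le> 1 / real L"
    using d by real_asymp
  then show ?thesis
    using N_close[of 1, simplified] wL_bounds eventually_ge_at_top[of 1]
  proof eventually_elim
    case (elim L)
    have L: "real L \<ge> 1" using elim(4) by simp
    have "(\<Sum>n\<le>N L. wL L n) \<le> (\<Sum>n\<le>N L. w n + 2 * \<theta> * real L powr - \<gamma> * (real n + 1) powr \<kappa>)"
      using elim(3) by (intro sum_mono) auto
    also have "\<dots> = (\<Sum>n\<le>N L. w n) + 2 * \<theta> * real L powr - \<gamma> * (\<Sum>n\<le>N L. (real n + 1) powr \<kappa>)"
      by (simp add: sum.distrib sum_distrib_left)
    also have "\<dots> \<le> 1 + c * real L powr (- 1 - d)"
    proof (rule add_mono)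
      show "(\<Sum>n\<le>N L. w n) \<le> 1"
        using w_sums w_nonneg sum_le_suminf[of w "{..N L}"] by (simp add: sums_iff)
      have "(\<Sum>n\<le>N L. (real n + 1) powr \<kappa>) \<le> (real (N L) + 1) powr (\<kappa> + 1) / min 1 (\<kappa> + 1)"
        using \<kappa>_gt by (rule sum_powr_le)
      also have "(real (N L) + 1) powr (\<kappa> + 1) \<le> ((\<rho> + 2) * real L) powr (\<kappa> + 1)"
        using elim(2) L \<kappa>_gt by (intro powr_mono2) (auto simp: algebra_simps)
      finally have le: "(\<Sum>n\<le>N L. (real n + 1) powr \<kappa>) \<le> (\<rho> + 2) powr (\<kappa> + 1) / min 1 (\<kappa> + 1) * real L powr (\<kappa> + 1)"
        using \<kappa>_gt \<rho>_pos by (simp add: powr_mult divide_right_mono)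
      have "2 * \<theta> * real L powr - \<gamma> * (\<Sum>n\<le>N L. (real n + 1) powr \<kappa>)
          \<le> 2 * \<theta> * real L powr - \<gamma> * ((\<rho> + 2) powr (\<kappa> + 1) / min 1 (\<kappa> + 1) * real L powr (\<kappa> + 1))"
        using le \<theta>_pos by (intro mult_left_mono) auto
      also have "\<dots> = c * (real L powr - \<gamma> * real L powr (\<kappa> + 1))"
        by (simp add: c_def)
      also have "real L powr - \<gamma> * real L powr (\<kappa> + 1) = real L powr (- \<gamma> + (\<kappa> + 1))"
        by (simp only: powr_add)
      also have "- \<gamma> + (\<kappa> + 1) = - 1 - d" by (simp add: d_def)
      finally show "2 * \<theta> * real L powr - \<gamma> * (\<Sum>n\<le>N L. (real n + 1) powr \<kappa>) \<le> c * real L powr (- 1 - d)" .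
    qed
    finally show ?case using elim(1) by linarith
  qed
qed

subsection \<open>Condensation on a single site\<close>

text \<open>The one event from which both limit laws are read off. The other sites are bounded one
  by one; their total stays of order \<open>L\<close> whenever \<open>\<rho>c > 0\<close>.\<close>

definition condensed :: "real \<Rightarrow> nat \<Rightarrow> config set" where
  "condensed e L = {\<eta> \<in> configs L (N L). \<exists>x\<in>sites L. \<bar>real (\<eta> x) - (\<rho> - \<rho>c) * real L\<bar> \<le> e * real L \<and>
     (\<forall>y\<in>sites L - {x}. real (\<eta> y) \<le> e * real L)}"

definition rest_atypical :: "real \<Rightarrow> real \<Rightarrow> nat \<Rightarrow> nat \<Rightarrow> config set" where
  "rest_atypical a e L x = {\<eta> \<in> configs L (N L). a * real L \<le> real (\<eta> x) \<and>
     restrict \<eta> (sites L - {x}) \<in> atypical (sites L - {x}) a e L}"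

definition two_large :: "real \<Rightarrow> nat \<Rightarrow> nat \<Rightarrow> nat \<Rightarrow> config set" where
  "two_large a L x y = {\<eta> \<in> configs L (N L). a * real L \<le> real (\<eta> x) \<and> a * real L \<le> real (\<eta> y)}"

lemma configs_le: "\<eta> \<in> configs L n \<Longrightarrow> x \<in> sites L \<Longrightarrow> \<eta> x \<le> n"
  using member_le_sum[of x "sites L" \<eta>] by (auto simp: configs_def)

text \<open>Cases by the number of sites above the truncation. With none, the density \<rho> is
  itself a deviation from \<rho>c. With two, nothing remains to be shown. With one and a typical
  rest, that site holds \<open>N L\<close> minus the rest, hence
  \<open>(\<rho> - \<rho>c) * L\<close> up to two errors \<open>e' * L\<close>, and the
  configuration would be condensed.\<close>

lemma not_condensed_subset:
  assumes N: "\<bar>real (N L) - \<rho> * real L\<bar> \<le> e' * real L"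
    and e: "2 * e' \<le> e" "2 * e' \<le> \<rho> - \<rho>c" and a: "a \<le> e" "a > 0"
  shows "configs L (N L) - condensed e L \<subseteq> (configs L (N L) \<inter> atypical (sites L) a e' L) \<union>
    ((\<Union>x\<in>sites L. rest_atypical a e' L x) \<union> (\<Union>(x, y)\<in>{(x, y) \<in> sites L \<times> sites L. x \<noteq> y}. two_large a L x y))"
proof
  fix \<eta> assume \<eta>: "\<eta> \<in> configs L (N L) - condensed e L"
  then have cfg: "\<eta> \<in> configs L (N L)" by simp
  then have ext: "\<eta> \<in> sites L \<rightarrow>\<^sub>E UNIV" and tot: "(\<Sum>x\<in>sites L. \<eta> x) = N L" by (auto simp: configs_def)
  define b where "b = nat \<lfloor>a * real L\<rfloor>"
  have big: "a * real L \<le> real n" if "n > b" for n using that unfolding b_def by linarith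
  have "real b = real_of_int \<lfloor>a * real L\<rfloor>" using a(2) by (simp add: b_def)
  then have "real b \<le> a * real L" by linarith
  also have "\<dots> \<le> e * real L" using a(1) by (intro mult_right_mono) auto
  finally have b: "real b \<le> e * real L" .
  show "\<eta> \<in> (configs L (N L) \<inter> atypical (sites L) a e' L) \<union>
    ((\<Union>x\<in>sites L. rest_atypical a e' L x) \<union> (\<Union>(x, y)\<in>{(x, y) \<in> sites L \<times> sites L. x \<noteq> y}. two_large a L x y))"
  proof (cases "\<exists>x\<in>sites L. \<eta> x > b")
    case False
    then have "\<eta> \<in> sites L \<rightarrow>\<^sub>E {..b}" using ext by (auto simp: PiE_iff not_less)
    moreover have "e' * real L \<le> \<bar>real (\<Sum>x\<in>sites L. \<eta> x) - \<rho>c * real L\<bar>"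
    proof -
      have "2 * e' * real L \<le> (\<rho> - \<rho>c) * real L" using e(2) by (intro mult_right_mono) auto
      then show ?thesis using N unfolding tot left_diff_distrib by linarith
    qed
    ultimately have "\<eta> \<in> atypical (sites L) a e' L"
      unfolding atypical_def b_def by blast
    then show ?thesis using cfg by blast
  next
    case True
    then obtain x where x: "x \<in> sites L" "\<eta> x > b" by blast
    show ?thesis
    proof (cases "\<exists>y\<in>sites L - {x}. \<eta> y > b")
      case True
      then obtain y where "y \<in> sites L" "y \<noteq> x" "\<eta> y > b" by blast
      then have "\<eta> \<in> two_large a L x y" using x cfg big by (auto simp: two_large_def)
      then show ?thesis using x(1) \<open>y \<in> sites L\<close> \<open>y \<noteq> x\<close> by blast
    next
      case False
      have S: "real (\<Sum>y\<in>sites L - {x}. restrict \<eta> (sites L - {x}) y) = real (N L) - real (\<eta> x)"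
        using tot sum.remove[OF _ x(1), of \<eta>] by simp
      have "\<eta> \<in> rest_atypical a e' L x"
      proof (rule ccontr)
        assume "\<eta> \<notin> rest_atypical a e' L x"
        then have "restrict \<eta> (sites L - {x}) \<notin> atypical (sites L - {x}) a e' L"
          using cfg big[OF x(2)] by (simp add: rest_atypical_def)
        moreover have "restrict \<eta> (sites L - {x}) \<in> sites L - {x} \<rightarrow>\<^sub>E {..b}"
          using False by (auto simp: not_less)
        ultimately have "\<not> e' * real L \<le> \<bar>real (\<Sum>y\<in>sites L - {x}. restrict \<eta> (sites L - {x}) y) - \<rho>c * real L\<bar>"
          unfolding atypical_def b_def by blast
        then have "\<bar>real (N L) - real (\<eta> x) - \<rho>c * real L\<bar> < e' * real L"
          by (simp only: S not_le)
        moreover have "2 * e' * real L \<le> e * real L" using e(1) by (intro mult_right_mono) auto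
        ultimately have "\<bar>real (\<eta> x) - (\<rho> - \<rho>c) * real L\<bar> \<le> e * real L"
          using N unfolding left_diff_distrib by linarith
        moreover have "real (\<eta> y) \<le> e * real L" if "y \<in> sites L - {x}" for y
        proof -
          have "\<eta> y \<le> b" using False that by (auto simp: not_less)
          then show ?thesis using b by linarith
        qed
        ultimately have "\<eta> \<in> condensed e L"
          using cfg x(1) unfolding condensed_def by blast
        then show False using \<eta> by simp
      qed
      then show ?thesis using x(1) by blast
    qed
  qed
qed

section \<open>Masses of the exceptional sets and a lower bound for the partition function\<close>

lemma rest_atypical_mass_le:
  assumes L: "L \<ge> 1" and x: "x \<in> sites L" and M: "M \<ge> 0"
    "\<And>n. n \<le> N L \<Longrightarrow> a * real L \<le> real n \<Longrightarrow> wL L n \<le> M"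
  shows "mass (wL L) (sites L) (rest_atypical a e L x) \<le> M * mass (wL L) (sites L - {x}) (atypical (sites L - {x}) a e L)"
proof (rule mass_slice_le[where N = "N L"])
  show "finite (atypical (sites L - {x}) a e L)"
    by (rule finite_atypical) simp
  show "\<And>\<eta>. \<eta> \<in> rest_atypical a e L x \<Longrightarrow> wL L (\<eta> x) \<le> M"
    using M(2) configs_le x by (auto simp: rest_atypical_def)
qed (use x M wL_pos[OF L] in \<open>auto simp: rest_atypical_def less_imp_le\<close>)

text \<open>The constraint eliminates only \<open>x\<close>, at cost \<open>M\<close>. The
  occupation of \<open>y\<close> remains free, at most \<open>N L\<close> values of weight at most
  \<open>M\<close>, and the remaining sites give at most
  \<open>(1 + 1 / L) ^ L \<le> exp 1\<close>.\<close>

lemma two_large_mass_le: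
  assumes L: "L \<ge> 1" and x: "x \<in> sites L" "y \<in> sites L" "x \<noteq> y" and M: "M \<ge> 0"
    "\<And>n. n \<le> N L \<Longrightarrow> a * real L \<le> real n \<Longrightarrow> wL L n \<le> M" and a: "a > 0"
    and tot: "(\<Sum>n\<le>N L. wL L n) \<le> 1 + 1 / real L"
  shows "mass (wL L) (sites L) (two_large a L x y) \<le> exp 1 * M\<^sup>2 * real (N L)"
proof -
  let ?A = "sites L - {x}"
  let ?B = "{n. n \<le> N L \<and> a * real L \<le> real n}"
  define D where "D = (\<lambda>z. if z = y then ?B else {..N L})"
  have W: "wL L n \<ge> 0" for n using wL_pos[OF L] by (rule less_imp_le)
  have "finite (D z)" for z by (simp add: D_def)
  have "mass (wL L) (sites L) (two_large a L x y) \<le> M * mass (wL L) ?A (PiE ?A D)"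
  proof (rule mass_slice_le[where N = "N L"])
    show "finite (PiE ?A D)" using \<open>\<And>z. finite (D z)\<close> by (intro finite_PiE) auto
    show "\<And>\<eta>. \<eta> \<in> two_large a L x y \<Longrightarrow> wL L (\<eta> x) \<le> M"
      using M(2) configs_le x by (auto simp: two_large_def)
    show "\<And>\<eta>. \<eta> \<in> two_large a L x y \<Longrightarrow> restrict \<eta> ?A \<in> PiE ?A D"
      using configs_le by (auto simp: two_large_def D_def PiE_iff split: if_splits)
  qed (use x M W in \<open>auto simp: two_large_def\<close>)
  also have "mass (wL L) ?A (PiE ?A D) = (\<Prod>z\<in>?A. \<Sum>n\<in>D z. wL L n)"
    using \<open>\<And>z. finite (D z)\<close> by (intro mass_PiE) auto
  also have "\<dots> = (\<Sum>n\<in>?B. wL L n) * (\<Prod>z\<in>?A - {y}. \<Sum>n\<in>D z. wL L n)"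
    using x by (subst prod.remove[of _ y]) (auto simp: D_def)
  also have "(\<Prod>z\<in>?A - {y}. \<Sum>n\<in>D z. wL L n) = (\<Prod>z\<in>?A - {y}. \<Sum>n\<le>N L. wL L n)"
    by (intro prod.cong) (auto simp: D_def)
  also have "M * ((\<Sum>n\<in>?B. wL L n) * (\<Prod>z\<in>?A - {y}. \<Sum>n\<le>N L. wL L n)) \<le> M * ((real (N L) * M) * exp 1)"
  proof (intro mult_left_mono mult_mono)
    show "(\<Sum>n\<in>?B. wL L n) \<le> real (N L) * M"
    proof -
      \<comment> \<open>Occupation 0 is not large, so there are at most \<open>N L\<close>
        admissible values and not one more.\<close>
      have "\<not> a * real L \<le> 0" using a L by (simp add: not_le)
      then have "?B \<subseteq> {1..N L}"
        by (auto simp: Suc_le_eq intro!: Nat.gr0I)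
      then have "card ?B \<le> N L" using card_mono[of "{1..N L}" ?B] by simp
      moreover have "(\<Sum>n\<in>?B. wL L n) \<le> real (card ?B) * M"
        using M(2) by (intro sum_bounded_above) auto
      ultimately show ?thesis using M(1) by (meson mult_right_mono of_nat_le_iff order_trans)
    qed
    have "(\<Prod>z\<in>?A - {y}. \<Sum>n\<le>N L. wL L n) = (\<Sum>n\<le>N L. wL L n) ^ card (?A - {y})" by simp
    also have "\<dots> \<le> (1 + 1 / real L) ^ card (?A - {y})"
      using tot W by (intro power_mono sum_nonneg) auto
    also have "\<dots> \<le> (1 + 1 / real L) ^ L"
    proof (rule power_increasing)
      have "card (?A - {y}) \<le> card (sites L)" by (intro card_mono) auto
      then show "card (?A - {y}) \<le> L" by simp
    qed simp
    also have "\<dots> \<le> exp (1 / real L) ^ L" by (intro power_mono exp_ge_add_one_self) auto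
    also have "\<dots> = exp 1" using L by (simp flip: exp_of_nat_mult)
    finally show "(\<Prod>z\<in>?A - {y}. \<Sum>n\<le>N L. wL L n) \<le> exp 1" .
  qed (use M(1) W in \<open>auto intro!: zero_le_power sum_nonneg\<close>)
  also have "\<dots> = exp 1 * M\<^sup>2 * real (N L)" by (simp add: power2_eq_square)
  finally show ?thesis by simp
qed

text \<open>Each of the \<open>L\<close> sites may hold the condensate, with weight at least
  \<open>m\<close> and a rest of mass at least 1/2. The condition
  \<open>a + 2 * e < \<rho> - \<rho>c\<close> keeps the condensate above the truncation despite the
  error in \<open>N L\<close> and that of the rest, so the gluing is injective.\<close>

lemma partition_fun_ge:
  assumes L: "L \<ge> 1" and a: "0 < a" "a + 2 * e < \<rho> - \<rho>c"
    and N: "\<bar>real (N L) - \<rho> * real L\<bar> \<le> e * real L"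
    and m: "\<And>n. n \<le> N L \<Longrightarrow> a * real L \<le> real n \<Longrightarrow> m \<le> wL L n" "m \<ge> 0"
    and half: "\<And>x. x \<in> sites L \<Longrightarrow> 1 / 2 \<le> mass (wL L) (sites L - {x}) (typical (sites L - {x}) a e L)"
  shows "real L * m / 2 \<le> partition_fun (wL L) L (N L)"
proof -
  define b where "b = nat \<lfloor>a * real L\<rfloor>"
  have "real b = real_of_int \<lfloor>a * real L\<rfloor>" using a(1) by (simp add: b_def)
  then have b: "real b \<le> a * real L" by linarith
  have gap: "a * real L + 2 * e * real L < (\<rho> - \<rho>c) * real L"
    using mult_strict_right_mono[OF a(2), of "real L"] L by (simp add: distrib_right)
  have far: "a * real L < real (N L) - real (\<Sum>y\<in>sites L - {x}. \<zeta> y)"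
    if "\<zeta> \<in> typical (sites L - {x}) a e L" for x \<zeta>
  proof -
    have "\<bar>real (\<Sum>y\<in>sites L - {x}. \<zeta> y) - \<rho>c * real L\<bar> < e * real L"
      using that by (simp add: typical_def)
    then show ?thesis using N gap unfolding left_diff_distrib by linarith
  qed
  have "real L * m / 2 = (\<Sum>x\<in>sites L. m * (1 / 2))" by simp
  also have "\<dots> \<le> (\<Sum>x\<in>sites L. m * mass (wL L) (sites L - {x}) (typical (sites L - {x}) a e L))"
    using half m(2) by (intro sum_mono mult_left_mono)
  also have "\<dots> \<le> partition_fun (wL L) L (N L)"
  proof (rule mass_slices_ge)
    show "typical (sites L - {x}) a e L \<subseteq> sites L - {x} \<rightarrow>\<^sub>E {..b}" for x
      by (auto simp: typical_def b_def)
    show "b + (\<Sum>y\<in>sites L - {x}. \<zeta> y) < N L" if "\<zeta> \<in> typical (sites L - {x}) a e L" for x \<zeta>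
    proof -
      have "real (b + (\<Sum>y\<in>sites L - {x}. \<zeta> y)) < real (N L)"
        using far[OF that] b by (simp only: of_nat_add)
      then show ?thesis by (simp only: of_nat_less_iff)
    qed
    show "m \<le> wL L (N L - (\<Sum>y\<in>sites L - {x}. \<zeta> y))" if "\<zeta> \<in> typical (sites L - {x}) a e L" for x \<zeta>
    proof (rule m(1))
      have "real (N L) - real (\<Sum>y\<in>sites L - {x}. \<zeta> y) \<le> real (N L - (\<Sum>y\<in>sites L - {x}. \<zeta> y))"
        by linarith
      then show "a * real L \<le> real (N L - (\<Sum>y\<in>sites L - {x}. \<zeta> y))"
        using far[OF that] by linarith
    qed simp
    show "wL L n \<ge> 0" for n using wL_pos[OF L] by (rule less_imp_le)
    have "\<rho>c * real L \<ge> 0" using \<rho>c_nonneg by simp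
    moreover have "e * real L \<ge> 0" using N by linarith
    ultimately have "real b \<le> real (N L)"
      using gap N b unfolding left_diff_distrib by linarith
    then show "b \<le> N L" by simp
  qed
  finally show ?thesis .
qed

lemma prob_condensed:
  assumes e: "e > 0"
  shows "(\<lambda>L. measure_pmf.prob (canonical (wL L) L (N L)) (condensed e L)) \<longlonglongrightarrow> 1"
proof -
  define g where "g = \<rho> - \<rho>c"
  have g: "g > 0" using supercritical by (simp add: g_def)
  \<comment> \<open>Two errors \<open>e'\<close> must fit into \<open>e\<close>; the bound
    \<open>g / 8\<close> gives, together with \<open>a \<le> g / 2\<close>, the inequality
    \<open>a + 2 * e' < g\<close>.\<close>
  define e' where "e' = min (e / 2) (g / 8)"
  have e': "e' > 0" "2 * e' \<le> e" "2 * e' \<le> g" "e' \<le> g / 8" using e g by (auto simp: e'_def)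
  define d where "d = \<gamma> - \<kappa> - 2"
  have d: "d > 0" using \<gamma>_gt by (simp add: d_def)
  have \<gamma>: "\<gamma> > 0" using \<gamma>_gt \<kappa>_gt by simp
  \<comment> \<open>The tilt constant for decay exponent \<gamma>, which beats the lower bound
    \<open>L powr (1 + \<kappa> - \<gamma>)\<close> of the partition function because \<kappa> >
    -1.\<close>
  define C where "C = (\<gamma> + 1) / e'"
  have C: "C > 0" using \<gamma> e' by (simp add: C_def)
  \<comment> \<open>The entries in turn: non-condensate sites stay below \<open>e * L\<close>, the
    condensate exceeds the truncation, the tilt is affordable, and the truncation lies below
    \<open>N L\<close>.\<close>
  define a where "a = Min {e, g / 2, d / 2 / C, \<rho> / 2}"
  have a: "a > 0" "a \<le> e" "a \<le> g / 2" "a \<le> d / 2 / C" "a \<le> \<rho> / 2"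
    using e g d C \<rho>_pos by (auto simp: a_def)
  have a\<rho>: "a < \<rho>" using a(5) \<rho>_pos by linarith
  have Ca: "(\<gamma> + 1) / e' * a \<le> (\<gamma> - \<kappa> - 2) / 2"
    using a(4) C unfolding C_def[symmetric] d_def[symmetric] by (simp add: field_simps)
  obtain m M where mM: "m > 0" "M > 0"
    "\<forall>\<^sub>F L in sequentially. \<forall>n\<le>N L. a * real L \<le> real n \<longrightarrow>
       m * real L powr (\<kappa> - \<gamma>) \<le> wL L n \<and> wL L n \<le> M * real L powr (\<kappa> - \<gamma>)"
    using wL_large_bounds[OF a(1)] by blast
  \<comment> \<open>The three bad masses divided by the lower bound \<open>L * m * q / 2\<close> of
    the partition function, with \<open>q = L powr (\<kappa> - \<gamma>)\<close>: no large site, one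
    large site with an atypical rest, two large sites.\<close>
  define r where "r L = 2 / m * (real L powr (- 1 - \<kappa>) + M * real L powr - \<gamma> + exp 1 * M\<^sup>2 * (\<rho> + 1) * real L powr - d)"
    for L :: nat
  have r: "r \<longlonglongrightarrow> 0"
  proof -
    have "(\<lambda>L. real L powr (- 1 - \<kappa>)) \<longlonglongrightarrow> 0" using \<kappa>_gt by real_asymp
    moreover have "(\<lambda>L. real L powr - \<gamma>) \<longlonglongrightarrow> 0" using \<gamma> by real_asymp
    moreover have "(\<lambda>L. real L powr - d) \<longlonglongrightarrow> 0" using d by real_asymp
    ultimately have "r \<longlonglongrightarrow> 2 / m * (0 + M * 0 + exp 1 * M\<^sup>2 * (\<rho> + 1) * 0)"
      unfolding r_def by (intro tendsto_intros)
    then show ?thesis by simp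
  qed
  have lower: "\<forall>\<^sub>F L in sequentially. 1 - r L \<le> measure_pmf.prob (canonical (wL L) L (N L)) (condensed e L)"
    using mM(3) N_close[OF e'(1)] N_close[of 1, simplified] total_le
      atypical_mass_le[where 'a = nat, OF e'(1) less_imp_le[OF \<gamma>] a(1) a\<rho> Ca]
      typical_mass_ge[where 'a = nat, OF e'(1) \<gamma> a(1) a\<rho> Ca] eventually_ge_at_top[of 1]
  proof eventually_elim
    case (elim L)
    note L = elim(7)
    define q where "q = real L powr (\<kappa> - \<gamma>)"
    have q: "q > 0" using L by (simp add: q_def)
    define Z where "Z = partition_fun (wL L) L (N L)"
    let ?E0 = "configs L (N L) \<inter> atypical (sites L) a e' L"
    let ?P = "{(x, y) \<in> sites L \<times> sites L. x \<noteq> y}"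
    let ?m = "mass (wL L) (sites L)"
    have W: "wL L n \<ge> 0" for n using wL_pos[OF L] by (rule less_imp_le)
    have fin: "finite E" if "E \<subseteq> configs L (N L)" for E using that finite_configs by (rule finite_subset)
    have finP: "finite ?P" by (rule finite_subset[of _ "sites L \<times> sites L"]) auto
    have sub: "rest_atypical a e' L x \<subseteq> configs L (N L)" "two_large a L x y \<subseteq> configs L (N L)" for x y
      by (auto simp: rest_atypical_def two_large_def)
    have subR: "(\<Union>x\<in>sites L. rest_atypical a e' L x) \<subseteq> configs L (N L)"
      and subT: "(\<Union>p\<in>?P. case p of (x, y) \<Rightarrow> two_large a L x y) \<subseteq> configs L (N L)"
      using sub by fast+
    have cards: "L - 1 \<le> card (sites L - {x}) \<and> card (sites L - {x}) \<le> L" if "x \<in> sites L" for x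
      using that by simp
    have "?m (configs L (N L) - condensed e L)
        \<le> ?m (?E0 \<union> ((\<Union>x\<in>sites L. rest_atypical a e' L x) \<union> (\<Union>p\<in>?P. case p of (x, y) \<Rightarrow> two_large a L x y)))"
      by (intro mass_mono fin W Un_least Int_lower1 subR subT
          not_condensed_subset[OF elim(2) e'(2) e'(3)[unfolded g_def] a(2,1)])
    also have "\<dots> \<le> ?m ?E0 + ?m ((\<Union>x\<in>sites L. rest_atypical a e' L x) \<union> (\<Union>p\<in>?P. case p of (x, y) \<Rightarrow> two_large a L x y))"
      by (intro mass_Un_le fin W Un_least Int_lower1 subR subT)
    also have "?m ((\<Union>x\<in>sites L. rest_atypical a e' L x) \<union> (\<Union>p\<in>?P. case p of (x, y) \<Rightarrow> two_large a L x y))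
        \<le> ?m (\<Union>x\<in>sites L. rest_atypical a e' L x) + ?m (\<Union>p\<in>?P. case p of (x, y) \<Rightarrow> two_large a L x y)"
      by (intro mass_Un_le fin W Un_least Int_lower1 subR subT)
    also have "?m (\<Union>x\<in>sites L. rest_atypical a e' L x) \<le> (\<Sum>x\<in>sites L. ?m (rest_atypical a e' L x))"
      by (intro mass_UN_le fin[OF sub(1)] W) simp
    also have "\<dots> \<le> (\<Sum>x\<in>sites L. M * q * real L powr - \<gamma>)"
    proof (rule sum_mono)
      fix x assume x: "x \<in> sites L"
      have "?m (rest_atypical a e' L x) \<le> M * q * mass (wL L) (sites L - {x}) (atypical (sites L - {x}) a e' L)"
        using elim(1) mM(2) q by (intro rest_atypical_mass_le[OF L x]) (auto simp: q_def)
      also have "\<dots> \<le> M * q * real L powr - \<gamma>"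
        using elim(5) cards[OF x] mM(2) q by (intro mult_left_mono) auto
      finally show "?m (rest_atypical a e' L x) \<le> M * q * real L powr - \<gamma>" .
    qed
    also have "?m (\<Union>p\<in>?P. case p of (x, y) \<Rightarrow> two_large a L x y) \<le> (\<Sum>p\<in>?P. ?m (case p of (x, y) \<Rightarrow> two_large a L x y))"
      using finP W by (intro mass_UN_le) (auto intro: fin[OF sub(2)])
    also have "\<dots> \<le> (\<Sum>p\<in>?P. exp 1 * (M * q)\<^sup>2 * ((\<rho> + 1) * real L))"
    proof (rule sum_mono)
      fix p assume "p \<in> ?P"
      then obtain x y where p: "p = (x, y)" "x \<in> sites L" "y \<in> sites L" "x \<noteq> y" by auto
      have "?m (two_large a L x y) \<le> exp 1 * (M * q)\<^sup>2 * real (N L)"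
        using elim(1) mM(2) q by (intro two_large_mass_le[OF L p(2-4) _ _ a(1) elim(4)]) (auto simp: q_def)
      also have "\<dots> \<le> exp 1 * (M * q)\<^sup>2 * ((\<rho> + 1) * real L)"
        using elim(3) by (intro mult_left_mono) (auto simp: distrib_right)
      finally show "?m (case p of (x, y) \<Rightarrow> two_large a L x y) \<le> exp 1 * (M * q)\<^sup>2 * ((\<rho> + 1) * real L)"
        by (simp add: p(1))
    qed
    also have "\<dots> \<le> (real L * real L) * (exp 1 * (M * q)\<^sup>2 * ((\<rho> + 1) * real L))"
    proof -
      have "card ?P \<le> card (sites L \<times> sites L)" by (intro card_mono) auto
      then have "real (card ?P) \<le> real L * real L" by (simp flip: of_nat_mult)
      then show ?thesis using \<rho>_pos by (simp add: mult_right_mono)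
    qed
    also have "?m ?E0 \<le> real L powr - \<gamma>"
    proof -
      have "?m ?E0 \<le> ?m (atypical (sites L) a e' L)"
        using W by (intro mass_mono finite_atypical) auto
      also have "\<dots> \<le> real L powr - \<gamma>" using elim(5) by simp
      finally show ?thesis .
    qed
    finally have bad: "?m (configs L (N L) - condensed e L) \<le> real L powr - \<gamma> +
        (real L * (M * q * real L powr - \<gamma>) + (real L * real L) * (exp 1 * (M * q)\<^sup>2 * ((\<rho> + 1) * real L)))"
      by simp
    have Z: "real L * (m * q) / 2 \<le> Z"
      unfolding Z_def
    proof (rule partition_fun_ge[OF L a(1) _ elim(2)])
      show "a + 2 * e' < \<rho> - \<rho>c" using a(3) e'(4) g unfolding g_def[symmetric] by linarith
      show "1 / 2 \<le> mass (wL L) (sites L - {x}) (typical (sites L - {x}) a e' L)" if "x \<in> sites L" for x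
        using cards[OF that] by (intro elim(6)[rule_format]) simp_all
      show "m * q \<le> wL L n" if "n \<le> N L" "a * real L \<le> real n" for n
        using elim(1) that by (simp add: q_def)
      show "m * q \<ge> 0" using mM(1) q by simp
    qed
    have rZ: "r L * (real L * (m * q) / 2) = real L powr - \<gamma> +
        (real L * (M * q * real L powr - \<gamma>) + (real L * real L) * (exp 1 * (M * q)\<^sup>2 * ((\<rho> + 1) * real L)))"
    proof -
      have 1: "real L powr (- 1 - \<kappa>) * (real L * q) = real L powr - \<gamma>"
        unfolding q_def by (simp add: powr_mult_base flip: powr_add)
      have 2: "real L powr - d = real L * real L * q"
      proof -
        have "- d = 1 + (1 + (\<kappa> - \<gamma>))" by (simp add: d_def)
        then show ?thesis by (simp add: q_def powr_mult_base mult.assoc)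
      qed
      have "r L * (real L * (m * q) / 2) = real L powr (- 1 - \<kappa>) * (real L * q) + M * real L powr - \<gamma> * (real L * q)
          + exp 1 * M\<^sup>2 * (\<rho> + 1) * real L powr - d * (real L * q)"
        unfolding r_def using mM(1) by (simp add: field_simps)
      also have "\<dots> = real L powr - \<gamma> + M * real L powr - \<gamma> * (real L * q)
          + exp 1 * M\<^sup>2 * (\<rho> + 1) * (real L * real L * q) * (real L * q)"
        unfolding 1 unfolding 2 ..
      finally show ?thesis by (simp add: power2_eq_square ac_simps)
    qed
    have r0: "r L \<ge> 0" unfolding r_def using mM \<rho>_pos by (intro mult_nonneg_nonneg add_nonneg_nonneg) auto
    have "?m (configs L (N L) - condensed e L) \<le> r L * Z"
      using bad Z r0 mult_left_mono[OF Z r0] unfolding rZ by linarith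
    moreover have Zpos: "Z > 0"
      using Z mM(1) q L by (smt (verit) divide_pos_pos mult_pos_pos of_nat_0_less_iff less_le_trans zero_less_one)
    ultimately have "?m (configs L (N L) - condensed e L) / Z \<le> r L"
      by (simp add: pos_divide_le_eq)
    moreover have "measure_pmf.prob (canonical (wL L) L (N L)) (configs L (N L) - condensed e L)
        = ?m (configs L (N L) - condensed e L) / Z"
      unfolding mass_def Z_def sum_divide_distrib using L wL_pos[OF L]
      by (subst measure_measure_pmf_finite) (auto simp: finite_configs pmf_canonical intro!: sum.cong)
    moreover have "measure_pmf.prob (canonical (wL L) L (N L)) (configs L (N L) - condensed e L)
        = 1 - measure_pmf.prob (canonical (wL L) L (N L)) (condensed e L)"
    proof -
      have "set_pmf (canonical (wL L) L (N L)) \<subseteq> configs L (N L)"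
        using L wL_pos[OF L] by (auto simp: set_pmf_eq pmf_canonical split: if_splits)
      then have "measure_pmf.prob (canonical (wL L) L (N L)) (configs L (N L)) = 1"
        by (simp add: measure_pmf.prob_eq_1 AE_measure_pmf_iff subset_iff)
      moreover have "condensed e L \<subseteq> configs L (N L)" by (auto simp: condensed_def)
      ultimately show ?thesis by (subst measure_pmf.finite_measure_Diff) auto
    qed
    ultimately show ?case by simp
  qed
  have "(\<lambda>L. 1 - r L) \<longlonglongrightarrow> 1" using tendsto_diff[OF tendsto_const r, of 1] by simp
  then show ?thesis
    by (rule tendsto_sandwich[OF lower always_eventually _ tendsto_const, rotated]) simp
qed

end

subsection \<open>The first site of the size-biased order\<close>

lemma prob_bind_pmf_ge:
  assumes "\<And>x. x \<in> G \<Longrightarrow> c \<le> measure_pmf.prob (f x) A"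
  shows "c * measure_pmf.prob p G \<le> measure_pmf.prob (bind_pmf p f) A"
proof (cases "c \<ge> 0")
  case True
  have "ennreal (c * measure_pmf.prob p G) = ennreal c * emeasure p G"
    using True by (simp add: ennreal_mult measure_pmf.emeasure_eq_measure)
  also have "\<dots> = (\<integral>\<^sup>+x. ennreal c * indicator G x \<partial>p)"
    by (simp add: nn_integral_cmult_indicator)
  also have "\<dots> \<le> (\<integral>\<^sup>+x. emeasure (f x) A \<partial>p)"
    using assms by (intro nn_integral_mono) (auto simp: indicator_def measure_pmf.emeasure_eq_measure intro: ennreal_leI)
  also have "\<dots> = ennreal (measure_pmf.prob (bind_pmf p f) A)"
    unfolding emeasure_bind_pmf[symmetric] by (rule measure_pmf.emeasure_eq_measure)
  finally show ?thesis by simp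
next
  \<comment> \<open>A negative \<open>c\<close> does occur as a hypothetical lower bound, and is
    then trivial.\<close>
  case False
  then have "c * measure_pmf.prob p G \<le> 0" by (intro mult_nonpos_nonneg) auto
  then show ?thesis using measure_nonneg[of "bind_pmf p f" A] by linarith
qed

text \<open>The lower bound applied to the complement. In this form the right-hand side tends to the
  limit of \<open>c\<close> when the probability of \<open>G\<close> tends to 1.\<close>

lemma prob_bind_pmf_le:
  assumes "\<And>x. x \<in> G \<Longrightarrow> measure_pmf.prob (f x) A \<le> c"
  shows "measure_pmf.prob (bind_pmf p f) A \<le> 1 - (1 - c) * measure_pmf.prob p G"
proof -
  have "(1 - c) * measure_pmf.prob p G \<le> measure_pmf.prob (bind_pmf p f) (- A)"
    using assms by (intro prob_bind_pmf_ge) (simp add: measure_pmf.prob_compl[of A, simplified, unfolded Compl_eq_Diff_UNIV[symmetric]])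
  also have "\<dots> = 1 - measure_pmf.prob (bind_pmf p f) A"
    using measure_pmf.prob_compl[of A "bind_pmf p f"] by (simp add: Compl_eq_Diff_UNIV)
  finally show ?thesis by simp
qed

text \<open>Later steps only overwrite later positions, so they leave the first pick and its law
  unchanged.\<close>

lemma size_biased_order_first:
  "map_pmf (\<lambda>\<sigma>. \<sigma> 1) (size_biased_order tie L N \<eta> (Suc k)) = next_site tie L N \<eta> 0 (\<lambda>_. undefined)"
proof (induction k)
  case 0
  show ?case by (simp add: bind_return_pmf pmf.map_comp o_def)
next
  case (Suc k)
  have "map_pmf (\<lambda>\<sigma>. \<sigma> 1) (size_biased_order tie L N \<eta> (Suc (Suc k))) =
      bind_pmf (size_biased_order tie L N \<eta> (Suc k))
        (\<lambda>\<sigma>. map_pmf (\<lambda>\<sigma>. \<sigma> 1) (map_pmf (\<lambda>x. \<sigma>(Suc (Suc k) := x)) (next_site tie L N \<eta> (Suc k) \<sigma>)))"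
    unfolding size_biased_order.simps(2)[of tie L N \<eta> "Suc k"] by (rule map_bind_pmf)
  also have "\<dots> = bind_pmf (size_biased_order tie L N \<eta> (Suc k)) (\<lambda>\<sigma>. return_pmf (\<sigma> 1))"
    by (intro bind_pmf_cong refl) (simp add: pmf.map_comp o_def)
  also have "\<dots> = map_pmf (\<lambda>\<sigma>. \<sigma> 1) (size_biased_order tie L N \<eta> (Suc k))"
    by (simp only: map_pmf_def)
  finally show ?case using Suc by simp
qed

lemma size_biased_first:
  assumes "L \<ge> 1"
  shows "map_pmf (\<lambda>\<eta>'. \<eta>' 1) (size_biased tie W L N) =
    bind_pmf (canonical W L N) (\<lambda>\<eta>. map_pmf \<eta> (next_site tie L N \<eta> 0 (\<lambda>_. undefined)))"
proof -
  obtain k where L: "L = Suc k" using assms by (cases L) auto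
  have "map_pmf (\<lambda>\<eta>'. \<eta>' 1) (map_pmf (\<lambda>\<sigma>. \<lambda>k\<in>{1..L}. \<eta> (\<sigma> k)) (size_biased_order tie L N \<eta> L))
      = map_pmf \<eta> (next_site tie L N \<eta> 0 (\<lambda>_. undefined))" for \<eta>
  proof -
    have "map_pmf (\<lambda>\<eta>'. \<eta>' 1) (map_pmf (\<lambda>\<sigma>. \<lambda>k\<in>{1..L}. \<eta> (\<sigma> k)) (size_biased_order tie L N \<eta> L))
        = map_pmf \<eta> (map_pmf (\<lambda>\<sigma>. \<sigma> 1) (size_biased_order tie L N \<eta> L))"
      unfolding pmf.map_comp using assms by (intro map_pmf_cong) auto
    then show ?thesis
      using size_biased_order_first[of tie L N \<eta> k] L by simp
  qed
  then show ?thesis by (simp add: size_biased_def map_bind_pmf)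
qed

text \<open>Before the first pick the number of collected particles is 0 < \<open>N\<close>, so the
  proportional rule is in force and not \<open>tie\<close>.\<close>

lemma pmf_first_site:
  assumes "\<eta> \<in> configs L N" "N > 0"
  shows "pmf (next_site tie L N \<eta> 0 (\<lambda>_. undefined)) x = (if x \<in> sites L then real (\<eta> x) / real N else 0)"
  using pmf_next_site[of \<eta> L N "\<lambda>_. undefined" 0 tie x] assms by simp

lemma cdf_distr_pmf: "cdf (distr (measure_pmf p) borel X) x = measure_pmf.prob p {\<omega>. X \<omega> \<le> x}"
  by (simp add: cdf_def measure_distr vimage_def)

subsection \<open>Limit laws\<close>

context condensation
begin

text \<open>The point mass is continuous away from \<open>g = \<rho> - \<rho>c\<close>. Below
  \<open>g\<close> a small enough window makes the event incompatible with condensation; above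
  \<open>g\<close> condensation with window \<open>x - g\<close> forces it, the other sites being
  below \<open>x * L\<close> too since \<open>g > 0\<close>.\<close>

lemma max_weak_conv:
  "weak_conv_m (\<lambda>L. distr (canonical (wL L) L (N L)) borel (\<lambda>\<eta>. real (Max (\<eta> ` sites L)) / real L))
     (return borel (\<rho> - \<rho>c))"
  unfolding weak_conv_m_def weak_conv_def
proof (intro allI impI)
  define g where "g = \<rho> - \<rho>c"
  have g: "g > 0" using supercritical by (simp add: g_def)
  let ?P = "\<lambda>L. measure_pmf.prob (canonical (wL L) L (N L))"
  interpret R: real_distribution "return borel g"
    by (intro real_distribution.intro prob_space_return) (simp_all add: real_distribution_axioms_def)
  have cdf: "cdf (return borel g) x = (if g \<le> x then 1 else 0)" for x
    by (simp add: cdf_def measure_return)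
  fix x assume "isCont (cdf (return borel (\<rho> - \<rho>c))) x"
  then have "measure (return borel g) {x} = 0" using R.isCont_cdf by (simp add: g_def)
  then have "x \<noteq> g" by (auto simp: measure_return)
  then consider "x < g" | "g < x" by linarith
  then have "(\<lambda>L. ?P L {\<eta>. real (Max (\<eta> ` sites L)) / real L \<le> x}) \<longlonglongrightarrow> (if g \<le> x then 1 else 0)"
  proof cases
    case 1
    define e where "e = (g - x) / 2"
    have e: "e > 0" "x < g - e" using 1 by (auto simp: e_def field_simps)
    have "\<forall>\<^sub>F L in sequentially. ?P L {\<eta>. real (Max (\<eta> ` sites L)) / real L \<le> x} \<le> 1 - ?P L (condensed e L)"
      using eventually_ge_at_top[of 1]
    proof eventually_elim
      case (elim L)
      have "{\<eta>. real (Max (\<eta> ` sites L)) / real L \<le> x} \<subseteq> - condensed e L"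
      proof
        fix \<eta> assume "\<eta> \<in> {\<eta>. real (Max (\<eta> ` sites L)) / real L \<le> x}"
        then have M: "real (Max (\<eta> ` sites L)) \<le> x * real L" using elim by (simp add: pos_divide_le_eq)
        show "\<eta> \<in> - condensed e L"
        proof
          assume "\<eta> \<in> condensed e L"
          then obtain y where y: "y \<in> sites L" "\<bar>real (\<eta> y) - g * real L\<bar> \<le> e * real L"
            by (auto simp: condensed_def g_def)
          have "\<eta> y \<le> Max (\<eta> ` sites L)" using y(1) by (intro Max_ge) auto
          then have "(g - e) * real L \<le> x * real L" using y(2) M unfolding left_diff_distrib by linarith
          then show False using e(2) elim by simp
        qed
      qed
      then have "?P L {\<eta>. real (Max (\<eta> ` sites L)) / real L \<le> x} \<le> ?P L (- condensed e L)"
        by (intro measure_pmf.finite_measure_mono) auto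
      then show ?case
        using measure_pmf.prob_compl[of "condensed e L" "canonical (wL L) L (N L)"] by (simp add: Compl_eq_Diff_UNIV)
    qed
    moreover have "(\<lambda>L. 1 - ?P L (condensed e L)) \<longlonglongrightarrow> 0"
      using tendsto_diff[OF tendsto_const prob_condensed[OF e(1)], of 1] by simp
    ultimately have "(\<lambda>L. ?P L {\<eta>. real (Max (\<eta> ` sites L)) / real L \<le> x}) \<longlonglongrightarrow> 0"
      by (rule tendsto_sandwich[OF always_eventually _ tendsto_const, rotated]) simp
    then show ?thesis using 1 by simp
  next
    case 2
    define e where "e = x - g"
    have e: "e > 0" using 2 by (simp add: e_def)
    have "\<forall>\<^sub>F L in sequentially. ?P L (condensed e L) \<le> ?P L {\<eta>. real (Max (\<eta> ` sites L)) / real L \<le> x}"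
      using eventually_ge_at_top[of 1]
    proof eventually_elim
      case (elim L)
      have "condensed e L \<subseteq> {\<eta>. real (Max (\<eta> ` sites L)) / real L \<le> x}"
      proof
        fix \<eta> assume "\<eta> \<in> condensed e L"
        then obtain z where z: "z \<in> sites L" "\<bar>real (\<eta> z) - g * real L\<bar> \<le> e * real L"
            "\<And>y. y \<in> sites L - {z} \<Longrightarrow> real (\<eta> y) \<le> e * real L"
          by (auto simp: condensed_def g_def)
        have xL: "x * real L = g * real L + e * real L" by (simp add: e_def left_diff_distrib)
        have le: "real (\<eta> y) \<le> x * real L" if "y \<in> sites L" for y
        proof (cases "y = z")
          case True
          show ?thesis unfolding True using z(2) xL by linarith
        next
          case False
          then have "real (\<eta> y) \<le> e * real L" using z(3) that by simp
          moreover have "g * real L \<ge> 0" using g by simp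
          ultimately show ?thesis using xL by linarith
        qed
        have "Max (\<eta> ` sites L) \<in> \<eta> ` sites L" using elim by (intro Max_in) auto
        then have "real (Max (\<eta> ` sites L)) \<le> x * real L" using le by auto
        then show "\<eta> \<in> {\<eta>. real (Max (\<eta> ` sites L)) / real L \<le> x}"
          using elim by (simp add: pos_divide_le_eq)
      qed
      then show ?case by (intro measure_pmf.finite_measure_mono) auto
    qed
    then have "(\<lambda>L. ?P L {\<eta>. real (Max (\<eta> ` sites L)) / real L \<le> x}) \<longlonglongrightarrow> 1"
      by (rule tendsto_sandwich[OF _ always_eventually prob_condensed[OF e] tendsto_const]) simp
    then show ?thesis using 2 by simp
  qed
  then show "(\<lambda>L. cdf (distr (canonical (wL L) L (N L)) borel (\<lambda>\<eta>. real (Max (\<eta> ` sites L)) / real L)) x)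
      \<longlonglongrightarrow> cdf (return borel (\<rho> - \<rho>c)) x"
    unfolding cdf_distr_pmf g_def[symmetric] cdf .
qed

lemma cdf_size_biased_first:
  assumes "L \<ge> 1"
  shows "cdf (distr (size_biased tie (wL L) L n) borel (\<lambda>\<eta>'. real (\<eta>' 1) / real L)) x =
    measure_pmf.prob (bind_pmf (canonical (wL L) L n) (\<lambda>\<eta>. map_pmf \<eta> (next_site tie L n \<eta> 0 (\<lambda>_. undefined))))
      {k. real k \<le> x * real L}"
proof -
  have "cdf (distr (size_biased tie (wL L) L n) borel (\<lambda>\<eta>'. real (\<eta>' 1) / real L)) x
      = measure_pmf.prob (map_pmf (\<lambda>\<eta>'. \<eta>' 1) (size_biased tie (wL L) L n)) {k. real k \<le> x * real L}"
    using assms by (simp add: cdf_distr_pmf vimage_def pos_divide_le_eq)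
  then show ?thesis
    unfolding size_biased_first[OF assms] .
qed

text \<open>Given a condensed configuration with condensate at \<open>z\<close>, the first pick is
  \<open>z\<close> with probability \<open>\<eta> z / N L\<close>. The three thresholds correspond
  to excluding \<open>z\<close>, including every other site, and including all sites.\<close>

lemma first_site_bounds:
  fixes tie :: "config \<Rightarrow> nat \<Rightarrow> (nat \<Rightarrow> nat) \<Rightarrow> nat pmf"
  assumes L: "L \<ge> 1" and N: "N L > 0" and \<eta>: "\<eta> \<in> condensed e L"
  defines "h x \<equiv> measure_pmf.prob (map_pmf \<eta> (next_site tie L (N L) \<eta> 0 (\<lambda>_. undefined))) {k. real k \<le> x * real L}"
  shows "x < \<rho> - \<rho>c - e \<Longrightarrow> h x \<le> 1 - (\<rho> - \<rho>c - e) * real L / real (N L)"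
    and "e \<le> x \<Longrightarrow> 1 - (\<rho> - \<rho>c + e) * real L / real (N L) \<le> h x"
    and "\<rho> - \<rho>c + e \<le> x \<Longrightarrow> h x = 1"
proof -
  define g where "g = \<rho> - \<rho>c"
  have g: "g > 0" using supercritical by (simp add: g_def)
  define T where "T = next_site tie L (N L) \<eta> 0 (\<lambda>_. undefined)"
  have h: "h x = measure_pmf.prob T {y. real (\<eta> y) \<le> x * real L}" for x
    unfolding h_def T_def[symmetric] by (simp add: vimage_def)
  have cfg: "\<eta> \<in> configs L (N L)" using \<eta> by (simp add: condensed_def)
  have T: "pmf T y = (if y \<in> sites L then real (\<eta> y) / real (N L) else 0)" for y
    unfolding T_def by (rule pmf_first_site[OF cfg N])
  have supp: "set_pmf T \<subseteq> sites L" using T by (auto simp: set_pmf_eq split: if_splits)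
  obtain z where z: "z \<in> sites L" "\<bar>real (\<eta> z) - g * real L\<bar> \<le> e * real L"
      "\<And>y. y \<in> sites L - {z} \<Longrightarrow> real (\<eta> y) \<le> e * real L"
    using \<eta> by (auto simp: condensed_def g_def)
  have Tz: "measure_pmf.prob T (- {z}) = 1 - real (\<eta> z) / real (N L)"
    using measure_pmf.prob_compl[of "{z}" T] z(1) T[of z] by (simp add: Compl_eq_Diff_UNIV measure_pmf_single)
  have z1: "(g - e) * real L \<le> real (\<eta> z)" "real (\<eta> z) \<le> (g + e) * real L"
    using z(2) unfolding left_diff_distrib distrib_right by linarith+
  show "h x \<le> 1 - (\<rho> - \<rho>c - e) * real L / real (N L)" if "x < \<rho> - \<rho>c - e"
  proof -
    have "x * real L < (g - e) * real L"
      using that L unfolding g_def by (intro mult_strict_right_mono) auto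
    then have "{y. real (\<eta> y) \<le> x * real L} \<subseteq> - {z}" using z1(1) by auto
    then have "h x \<le> 1 - real (\<eta> z) / real (N L)"
      unfolding h Tz[symmetric] by (intro measure_pmf.finite_measure_mono) auto
    also have "\<dots> \<le> 1 - (g - e) * real L / real (N L)"
      using z1(1) by (simp add: divide_right_mono)
    finally show ?thesis by (simp add: g_def)
  qed
  have e0: "e * real L \<ge> 0" using z(2) by linarith
  show "1 - (\<rho> - \<rho>c + e) * real L / real (N L) \<le> h x" if "e \<le> x"
  proof -
    have ex: "e * real L \<le> x * real L" using that by (intro mult_right_mono) auto
    have "1 - (g + e) * real L / real (N L) \<le> 1 - real (\<eta> z) / real (N L)"
      using z1(2) by (simp add: divide_right_mono)
    \<comment> \<open>Off \<open>sites L\<close> the configuration is \<open>undefined\<close>, so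
      the comparison has to be made inside the support.\<close>
    also have "\<dots> = measure_pmf.prob T (- {z} \<inter> set_pmf T)"
      unfolding Tz[symmetric] by (simp add: measure_Int_set_pmf)
    also have "\<dots> \<le> h x"
    proof -
      have "real (\<eta> y) \<le> x * real L" if "y \<in> - {z} \<inter> set_pmf T" for y
        using z(3)[of y] that supp ex by force
      then show ?thesis unfolding h by (intro measure_pmf.finite_measure_mono) auto
    qed
    finally show ?thesis by (simp add: g_def)
  qed
  show "h x = 1" if "\<rho> - \<rho>c + e \<le> x"
  proof -
    have xL: "(g + e) * real L \<le> x * real L" using that unfolding g_def by (intro mult_right_mono) auto
    have gL: "g * real L \<ge> 0" using g by simp
    have "real (\<eta> y) \<le> x * real L" if "y \<in> set_pmf T" for y
    proof (cases "y = z")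
      case True
      show ?thesis unfolding True using z1(2) xL by linarith
    next
      case False
      then have "real (\<eta> y) \<le> e * real L" using z(3)[of y] that supp by blast
      then show ?thesis using xL gL unfolding distrib_right by linarith
    qed
    then show ?thesis unfolding h by (auto simp: measure_pmf.prob_eq_1 AE_measure_pmf_iff)
  qed
qed

lemma L_over_N: "(\<lambda>L. real L / real (N L)) \<longlonglongrightarrow> 1 / \<rho>"
  using tendsto_inverse[OF density] \<rho>_pos by (simp add: inverse_eq_divide)

text \<open>On the condensed event the first pick lands on the condensate with probability near
  \<open>g / \<rho>\<close>, by \<open>L / N L\<close> tending to \<open>1 / \<rho>\<close>. The
  continuity points avoid \<open>g\<close>, but they include 0 when the lower atom has no mass, that
  is when \<open>g = \<rho>\<close>.\<close>

lemma size_biased_weak_conv: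
  "weak_conv_m (\<lambda>L. distr (size_biased (tie L) (wL L) L (N L)) borel (\<lambda>\<eta>'. real (\<eta>' 1) / real L))
     (distr (bernoulli_pmf ((\<rho> - \<rho>c) / \<rho>)) borel (\<lambda>b. if b then \<rho> - \<rho>c else 0))"
  unfolding weak_conv_m_def weak_conv_def
proof (intro allI impI)
  define g where "g = \<rho> - \<rho>c"
  have g: "g > 0" "g \<le> \<rho>" using supercritical \<rho>c_nonneg by (auto simp: g_def)
  define Q where "Q = distr (bernoulli_pmf (g / \<rho>)) borel (\<lambda>b. if b then g else 0)"
  have q: "0 < g / \<rho>" "g / \<rho> \<le> 1" using g \<rho>_pos by auto
  interpret Q: real_distribution Q
    unfolding Q_def by (intro real_distribution.intro measure_pmf.prob_space_distr) (simp_all add: real_distribution_axioms_def)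
  have single: "measure_pmf.prob (bernoulli_pmf (g / \<rho>)) {True} = g / \<rho>"
      "measure_pmf.prob (bernoulli_pmf (g / \<rho>)) {False} = 1 - g / \<rho>"
    using q by (simp_all add: measure_pmf_single)
  have Qx: "cdf Q x = (if x < 0 then 0 else if x < g then 1 - g / \<rho> else 1)" for x
  proof -
    have "{b. (if b then g else 0) \<le> x} = (if x < 0 then {} else if x < g then {False} else UNIV)"
      using g(1) by (auto split: if_splits)
    then show ?thesis unfolding Q_def cdf_distr_pmf using single by simp
  qed
  fix x
  define F where "F L = cdf (distr (size_biased (tie L) (wL L) L (N L)) borel (\<lambda>\<eta>'. real (\<eta>' 1) / real L)) x" for L
  define P where "P e L = measure_pmf.prob (canonical (wL L) L (N L)) (condensed e L)" for e L
  have P: "P e \<longlonglongrightarrow> 1" if "e > 0" for e using prob_condensed[OF that] by (simp add: P_def[abs_def])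
  have F01: "0 \<le> F L" "F L \<le> 1" for L by (simp_all add: F_def cdf_distr_pmf)
  assume "isCont (cdf (distr (bernoulli_pmf ((\<rho> - \<rho>c) / \<rho>)) borel (\<lambda>b. if b then \<rho> - \<rho>c else 0))) x"
  then have Q0: "measure Q {x} = 0"
    unfolding g_def[symmetric] Q_def[symmetric] by (simp only: Q.isCont_cdf)
  have "x \<noteq> g"
  proof
    assume "x = g"
    then have "(\<lambda>b. if b then g else 0) -` {x} = {True}" using g(1) by (auto split: if_splits)
    then show False using Q0 single g(1) \<rho>_pos by (simp add: Q_def measure_distr)
  qed
  have x0: "g = \<rho>" if "x = 0"
  proof -
    have "(\<lambda>b. if b then g else 0) -` {x} = {False}" using g(1) that by (auto split: if_splits)
    then show ?thesis using Q0 single q(1) \<rho>_pos by (simp add: Q_def measure_distr)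
  qed
  have Npos: "\<forall>\<^sub>F L in sequentially. N L > 0"
  proof -
    have "\<forall>\<^sub>F L in sequentially. real (N L) / real L > 0" using density \<rho>_pos by (rule order_tendstoD)
    then show ?thesis by eventually_elim (auto intro: Nat.gr0I)
  qed
  have lo: "\<forall>\<^sub>F L in sequentially. (1 - (g + e) * (real L / real (N L))) * P e L \<le> F L" if "e \<le> x" for e
    using eventually_ge_at_top[of 1] Npos
  proof eventually_elim
    case (elim L)
    show ?case
      unfolding F_def cdf_size_biased_first[OF elim(1)] P_def
      using first_site_bounds(2)[where e = e and x = x and tie = "tie L", OF elim] that by (intro prob_bind_pmf_ge) (simp add: g_def)
  qed
  \<comment> \<open>The nested differences keep the shape \<open>1 - (1 - c) * P\<close> of the
    general bound.\<close>
  have hi: "\<forall>\<^sub>F L in sequentially. F L \<le> 1 - (1 - (1 - (g - e) * (real L / real (N L)))) * P e L" if "x < g - e" for e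
    using eventually_ge_at_top[of 1] Npos
  proof eventually_elim
    case (elim L)
    show ?case
      unfolding F_def cdf_size_biased_first[OF elim(1)] P_def
      using first_site_bounds(1)[where e = e and x = x and tie = "tie L", OF elim] that by (intro prob_bind_pmf_le) (simp add: g_def)
  qed
  consider "x < 0" | "0 \<le> x" "x < g" | "x > g" using \<open>x \<noteq> g\<close> by linarith
  then have "F \<longlonglongrightarrow> cdf Q x"
  proof cases
    case 1
    have "F L = 0" for L
    proof -
      have "{\<eta>' :: config. real (\<eta>' 1) / real L \<le> x} = {}" using 1 by (auto simp: not_le intro: less_le_trans)
      then show ?thesis by (simp add: F_def cdf_distr_pmf)
    qed
    then have "F = (\<lambda>_. 0)" by auto
    then show ?thesis using 1 by (simp add: Qx)
  next
    case 2
    have "F \<longlonglongrightarrow> 1 - g / \<rho>"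
    proof (rule order_tendstoI)
      fix y assume y: "y < 1 - g / \<rho>"
      show "\<forall>\<^sub>F L in sequentially. y < F L"
      \<comment> \<open>At \<open>x = 0\<close> no positive window satisfies
        \<open>e \<le> x\<close>. But then \<open>g = \<rho>\<close>, the limit is 0, and
        \<open>F L \<ge> 0\<close> suffices.\<close>
      proof (cases "x = 0")
        case True
        then have "y < 0" using x0 y \<rho>_pos by simp
        then have "y < F L" for L using F01(1)[of L] by linarith
        then show ?thesis by simp
      next
        case False
        \<comment> \<open>The slack of \<open>y\<close> scaled by \<rho>: the limit
          \<open>1 - (g + e) / \<rho>\<close> of the lower bound exceeds \<open>y\<close> if and
          only if \<open>e < t\<close>.\<close>
        define t where "t = \<rho> - g - \<rho> * y"
        have t: "t > 0" using y \<rho>_pos by (simp add: t_def field_simps)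
        define e where "e = min x (t / 2)"
        have e: "e > 0" "e \<le> x" "e < t" using False 2 t by (auto simp: e_def min_def)
        have "y < (1 - (g + e) * (1 / \<rho>)) * 1" using e(3) \<rho>_pos unfolding t_def by (simp add: field_simps)
        moreover have "(\<lambda>L. (1 - (g + e) * (real L / real (N L))) * P e L) \<longlonglongrightarrow> (1 - (g + e) * (1 / \<rho>)) * 1"
          by (intro L_over_N P[OF e(1)] tendsto_const tendsto_mult tendsto_diff)
        ultimately have "\<forall>\<^sub>F L in sequentially. y < (1 - (g + e) * (real L / real (N L))) * P e L"
          by (simp only: order_tendstoD(1))
        then show ?thesis using lo[OF e(2)] by eventually_elim linarith
      qed
    next
      fix y assume y: "1 - g / \<rho> < y"
      \<comment> \<open>Likewise for the upper bound, whose limit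
        \<open>1 - (g - e) / \<rho>\<close> is below \<open>y\<close> if and only if
        \<open>e < t\<close>.\<close>
      define t where "t = \<rho> * y - \<rho> + g"
      have t: "t > 0" using y \<rho>_pos by (simp add: t_def field_simps)
      define e where "e = min ((g - x) / 2) (t / 2)"
      have e: "e > 0" "x < g - e" "e < t" using 2 t by (auto simp: e_def min_def field_simps)
      have "1 - (1 - (1 - (g - e) * (1 / \<rho>))) * 1 < y" using e(3) \<rho>_pos unfolding t_def by (simp add: field_simps)
      moreover have "(\<lambda>L. 1 - (1 - (1 - (g - e) * (real L / real (N L)))) * P e L)
          \<longlonglongrightarrow> 1 - (1 - (1 - (g - e) * (1 / \<rho>))) * 1"
        by (intro L_over_N P[OF e(1)] tendsto_const tendsto_mult tendsto_diff)
      ultimately have "\<forall>\<^sub>F L in sequentially. 1 - (1 - (1 - (g - e) * (real L / real (N L)))) * P e L < y"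
        by (simp only: order_tendstoD(2))
      then show "\<forall>\<^sub>F L in sequentially. F L < y" using hi[OF e(2)] by eventually_elim linarith
    qed
    then show ?thesis using 2 by (simp add: Qx)
  next
    case 3
    define e where "e = x - g"
    have e: "e > 0" using 3 by (simp add: e_def)
    have "\<forall>\<^sub>F L in sequentially. P e L \<le> F L"
      using eventually_ge_at_top[of 1] Npos
    proof eventually_elim
      case (elim L)
      have "1 * P e L \<le> F L"
        unfolding F_def cdf_size_biased_first[OF elim(1)] P_def
        using first_site_bounds(3)[where e = e and x = x and tie = "tie L", OF elim] by (intro prob_bind_pmf_ge) (simp add: g_def e_def)
      then show ?case by simp
    qed
    then have "F \<longlonglongrightarrow> 1"
      using F01(2) by (intro tendsto_sandwich[OF _ always_eventually P[OF e] tendsto_const]) auto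
    then show ?thesis using 3 g(1) by (simp add: Qx)
  qed
  then show "(\<lambda>L. cdf (distr (size_biased (tie L) (wL L) L (N L)) borel (\<lambda>\<eta>'. real (\<eta>' 1) / real L)) x)
      \<longlonglongrightarrow> cdf (distr (bernoulli_pmf ((\<rho> - \<rho>c) / \<rho>)) borel (\<lambda>b. if b then \<rho> - \<rho>c else 0)) x"
    unfolding F_def[abs_def] Q_def g_def .
qed

end

theorem theorem3:
  fixes w :: "nat \<Rightarrow> real"
    and wL \<delta> :: "nat \<Rightarrow> nat \<Rightarrow> real"
    and \<theta> \<gamma> \<kappa> \<rho> :: real
    and \<phi>bar :: ereal
    and N :: "nat \<Rightarrow> nat"
    and tie :: "nat \<Rightarrow> config \<Rightarrow> nat \<Rightarrow> (nat \<Rightarrow> nat) \<Rightarrow> nat pmf"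
  assumes "\<theta> > 0" and "\<gamma> > 0" and "\<kappa> > -1"
    and wL_form: "\<And>L n. L \<ge> 1 \<Longrightarrow>
          wL L n = w n + \<theta> / real L powr \<gamma> * (real n + 1) powr \<kappa> * (1 + \<delta> L n)"
    and wL_pos: "\<And>L n. L \<ge> 1 \<Longrightarrow> wL L n > 0"
    and \<delta>_small: "(\<lambda>L. real L * (SUP n\<in>{..N L}. \<bar>\<delta> L n\<bar>)) \<longlonglongrightarrow> 0"
    and w_nonneg: "\<And>n. w n \<ge> 0"
    and \<phi>bar_gt_1: "\<phi>bar > 1"
    and z_finite: "\<And>\<phi>. \<phi> \<ge> 0 \<Longrightarrow> summable (\<lambda>n. w n * \<phi> ^ n) \<longleftrightarrow> ereal \<phi> < \<phi>bar"
    and w_sums: "w sums 1"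
    and \<rho>c_finite: "summable (\<lambda>n. real n * w n)"
    and R_surj: "\<And>r. r \<ge> 0 \<Longrightarrow> \<exists>\<phi>\<ge>0. ereal \<phi> < \<phi>bar \<and> bulk_density w \<phi> = r"
    and exponents: "\<gamma> > \<kappa> + 2" "\<kappa> + 2 > 1"
    and N_infinity: "filterlim N at_top sequentially"
    and density: "(\<lambda>L. real (N L) / real L) \<longlonglongrightarrow> \<rho>"
    and supercritical: "\<rho> > critical_density w"
    and tie: "\<And>L. valid_tie L (tie L)"
  shows "weak_conv_m
           (\<lambda>L. distr (canonical (wL L) L (N L)) borel (\<lambda>\<eta>. real (Max (\<eta> ` sites L)) / real L))
           (return borel (\<rho> - critical_density w))
       \<and> weak_conv_m
           (\<lambda>L. distr (size_biased (tie L) (wL L) L (N L)) borel (\<lambda>\<eta>'. real (\<eta>' 1) / real L))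
           (distr (bernoulli_pmf ((\<rho> - critical_density w) / \<rho>)) borel
              (\<lambda>b. if b then \<rho> - critical_density w else 0))"
proof -
  have "ereal 1 < \<phi>bar" using \<phi>bar_gt_1 by (simp add: one_ereal_def)
  \<comment> \<open>A point strictly between 1 and \<open>\<phi>bar\<close> supplies the exponential
    moment required by the locale.\<close>
  then obtain \<phi> where \<phi>: "1 < \<phi>" "ereal \<phi> < \<phi>bar"
    using ereal_dense2 by fastforce
  then have "summable (\<lambda>n. w n * \<phi> ^ n)" using z_finite[of \<phi>] by simp
  then interpret condensation w wL \<delta> \<theta> \<gamma> \<kappa> \<rho> \<phi> N
    using assms \<phi>(1) by unfold_locales auto
  show ?thesis using max_weak_conv size_biased_weak_conv by blast
qed

end
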